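(* Let $\kappa\ge 1$, let $(E,\|\cdot\|)$ be a finite-dimensional $\kappa$-regular normed space, let $\alpha\in[1,2]$, let $\sigma_1,\sigma_2,\dots$ be deterministic positive reals, and let $\xi^\infty=\{\xi_i\}_{i=1}^\infty$ be an $E$-valued martingale-difference with respect to the filtration $\{\mathcal F_i\}$ such that $$\forall i\ge 1:\quad \mathbf{E}_{i-1}\left\{\exp\{\|\xi_i\|^\alpha\sigma_i^{-\alpha}\}\right\}\le \exp\{1\}\ \text{ almost surely.}\qquad (\mathcal C_\alpha)$$ Let $S_N=\sum_{i=1}^N\xi_i$ and $\sigma^N=[\sigma_1;\dots;\sigma_N]\in\mathbf R^N$. Then: (i) For $1\le\alpha\le 2$, for all $N\ge1$ and $\gamma\ge0$, $$\mathrm{Prob}\left\{\|S_N\|\ge\left[\sqrt{2e\kappa}+\sqrt2\,\gamma\right]\sqrt{\sum_{i=1}^N\sigma_i^2}\right\}\le 2\exp\left\{-\tfrac1{64}\min\left[\gamma^2;\gamma_*^{2-\alpha}\gamma^\alpha\right]\right\},$$ where $\gamma_*=\gamma_*(\alpha,\sigma^N)$ is defined as follows: if $1<\alpha<2$, then with $\alpha_*=\frac{\alpha}{\alpha-1}$, $$\gamma_*=32\left[\frac{8\alpha_*}{2^{\alpha_*}}\right]^{\frac{\alpha-1}{2-\alpha}}\left[\frac{\|\sigma^N\|_2}{\|\sigma^N\|_{\alpha_*}}\right]^{\frac{\alpha}{2-\alpha}}\ \ge\ 16\left[\frac{\|\sigma^N\|_2}{\|\sigma^N\|_{\alpha_*}}\right]^{\frac{\alpha}{2-\alpha}}\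 \ge\ 16;$$ if $\alpha=1$, then $\gamma_*=\lim_{\alpha\to1+0}\gamma_*(\alpha,\sigma^N)=16\frac{\|\sigma^N\|_2}{\|\sigma^N\|_\infty}$; if $\alpha=2$, then $\gamma_*=\lim_{\alpha\to2-0}\gamma_*(\alpha,\sigma^N)=+\infty$ (in which case the minimum in the bound is understood as $\gamma^2$). (ii) When $\alpha=2$, the bound improves to: for all $N\ge1$, $\gamma\ge0$, $$\mathrm{Prob}\left\{\|S_N\|\ge\left[\sqrt{2\kappa}+\sqrt2\,\gamma\right]\sqrt{\sum_{i=1}^N\sigma_i^2}\right\}\le\exp\{-\gamma^2/3\}.$$ (iii) When the condition $\mathbf E_{i-1}\{\exp\{\|\xi_i\|^2\sigma_i^{-2}\}\}\le\exp\{1\}$ in $(\mathcal C_2)$ is strengthened to $\|\xi_i\|\le\sigma_i$ almost surely, $i=1,2,\dots$, the bound improves to: for all $N\ge1$, $\gamma\ge0$, $$\mathrm{Prob}\left\{\|S_N\|\ge\left[\sqrt{2\kappa}+\sqrt2\,\gamma\right]\sqrt{\sum_{i=1}^N\sigma_i^2}\right\}\le\exp\{-\gamma^2/2\}.$$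
   Context: Probabilistic setting: $\Omega$ is a Polish space with a Borel probability measure $\mu$; $\mathcal F_0=\{\emptyset,\Omega\}\subset\mathcal F_1\subset\mathcal F_2\subset\dots$ are $\sigma$-sub-algebras of the Borel $\sigma$-algebra of $\Omega$; $\mathbf E_i$ is the conditional expectation with respect to $\mathcal F_i$, and $\mathbf E=\mathbf E_0$ is the expectation with respect to $\mu$. An $E$-valued martingale-difference is a sequence of Borel functions $\xi_i:\Omega\to E$ such that $\xi_i$ is $\mathcal F_i$-measurable and $\mathbf E_{i-1}\{\xi_i\}=0$ for $i=1,2,\dots$. Relations between random variables hold almost surely. For a vector $\nu\in\mathbf R^N$, $\|\nu\|_q$ is the $\ell_q$-norm. Smoothness and regularity: let $(E,\|\cdot\|)$ be a finite-dimensional (real) normed space and $\kappa\ge1$. The space $(E,\|\cdot\|)$ (and the norm $\|\cdot\|$) is called $\kappa$-smooth if the function $p(x)=\|x\|^2$ is continuously differentiable and $p(x+y)\le p(x)+Dp(x)[y]+\kappa p(y)$ for all $x,y\in E$. The space $(E,\|\cdot\|)$ (and the norm $\|\cdot\|$) is called $\kappa$-regular if there exist $\kappa_+\in[1,\kappa]$ and a norm $\|\cdot\|_+$ on $E$ such that $(E,\|\cdot\|_+)$ is $\kappa_+$-smooth and $\|x\|^2\le\|x\|_+^2\le\frac{\kappa}{\kappa_+}\|x\|^2$ for all $x\in E$. *)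

theory Defs
  imports "HOL-Probability.Probability"
begin

definition is_norm :: "('e::real_vector \<Rightarrow> real) \<Rightarrow> bool" where
  "is_norm nrm \<longleftrightarrow>
     (\<forall>x. nrm x = 0 \<longleftrightarrow> x = 0) \<and>
     (\<forall>c x. nrm (c *\<^sub>R x) = \<bar>c\<bar> * nrm x) \<and>
     (\<forall>x y. nrm (x + y) \<le> nrm x + nrm y)"

text \<open>Smoothness of an arbitrary norm \<open>nrm\<close>, not necessarily the norm of the type class.
  Continuous differentiability refers to the topology of the type class norm; on a
  finite-dimensional space all norms induce the same topology, so this is
  the intended notion for \<open>nrm\<close> as well.\<close>

definition kappa_smooth :: "real \<Rightarrow> ('e::real_normed_vector \<Rightarrow> real) \<Rightarrow> bool" where
  "kappa_smooth \<kappa> nrm \<longleftrightarrow>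
     (\<exists>D :: 'e \<Rightarrow> 'e \<Rightarrow>\<^sub>L real.
        (\<forall>x. ((\<lambda>z. (nrm z)\<^sup>2) has_derivative blinfun_apply (D x)) (at x)) \<and>
        continuous_on UNIV D \<and>
        (\<forall>x y. (nrm (x + y))\<^sup>2 \<le> (nrm x)\<^sup>2 + blinfun_apply (D x) y + \<kappa> * (nrm y)\<^sup>2))"

definition kappa_regular :: "real \<Rightarrow> ('e::real_normed_vector \<Rightarrow> real) \<Rightarrow> bool" where
  "kappa_regular \<kappa> nrm \<longleftrightarrow>
     (\<exists>\<kappa>p nrmp. 1 \<le> \<kappa>p \<and> \<kappa>p \<le> \<kappa> \<and> is_norm nrmp \<and> kappa_smooth \<kappa>p nrmp \<and>
        (\<forall>x. (nrm x)\<^sup>2 \<le> (nrmp x)\<^sup>2 \<and> (nrmp x)\<^sup>2 \<le> \<kappa> / \<kappa>p * (nrm x)\<^sup>2))"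

text \<open>\<open>g\<close> is a version of the conditional expectation of the vector-valued random variable \<open>f\<close>;
  the library only has the scalar versions \<open>real_cond_exp\<close> and \<open>nn_cond_exp\<close>.\<close>

definition has_cond_exp ::
    "'w measure \<Rightarrow> 'w measure \<Rightarrow> ('w \<Rightarrow> 'e::{banach, second_countable_topology}) \<Rightarrow> ('w \<Rightarrow> 'e) \<Rightarrow> bool" where
  "has_cond_exp M G f g \<longleftrightarrow>
     integrable M f \<and> integrable M g \<and> g \<in> borel_measurable G \<and>
     (\<forall>A\<in>sets G. set_lebesgue_integral M A f = set_lebesgue_integral M A g)"

text \<open>Sequences are indexed from 1; \<open>\<xi> 0\<close> is irrelevant.\<close>

definition martingale_difference ::
    "'w measure \<Rightarrow> (nat \<Rightarrow> 'w measure) \<Rightarrow> (nat \<Rightarrow> 'w \<Rightarrow> 'e::{banach, second_countable_topology}) \<Rightarrow> bool" where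
  "martingale_difference M F \<xi> \<longleftrightarrow>
     (\<forall>i\<ge>1. \<xi> i \<in> borel_measurable (F i) \<and> has_cond_exp M (F (i - 1)) (\<xi> i) (\<lambda>_. 0))"

definition cond_C ::
    "'w measure \<Rightarrow> (nat \<Rightarrow> 'w measure) \<Rightarrow> (nat \<Rightarrow> real) \<Rightarrow> (nat \<Rightarrow> 'w \<Rightarrow> 'e::real_normed_vector) \<Rightarrow> real \<Rightarrow> bool" where
  "cond_C M F \<sigma> \<xi> \<alpha> \<longleftrightarrow>
     (\<forall>i\<ge>1. AE \<omega> in M.
        nn_cond_exp M (F (i - 1))
          (\<lambda>\<omega>'. ennreal (exp (norm (\<xi> i \<omega>') powr \<alpha> * \<sigma> i powr (- \<alpha>)))) \<omega> \<le> ennreal (exp 1))"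

definition lq_norm :: "real \<Rightarrow> (nat \<Rightarrow> real) \<Rightarrow> nat \<Rightarrow> real" where
  "lq_norm q \<sigma> N = (\<Sum>i=1..N. \<bar>\<sigma> i\<bar> powr q) powr (1 / q)"

definition linf_norm :: "(nat \<Rightarrow> real) \<Rightarrow> nat \<Rightarrow> real" where
  "linf_norm \<sigma> N = Max ((\<lambda>i. \<bar>\<sigma> i\<bar>) ` {1..N})"

definition alpha_star :: "real \<Rightarrow> real" where
  "alpha_star \<alpha> = \<alpha> / (\<alpha> - 1)"

definition gamma_star :: "real \<Rightarrow> (nat \<Rightarrow> real) \<Rightarrow> nat \<Rightarrow> ereal" where
  "gamma_star \<alpha> \<sigma> N =
     (if \<alpha> = 1 then ereal (16 * (lq_norm 2 \<sigma> N / linf_norm \<sigma> N))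
      else if \<alpha> = 2 then \<infinity>
      else ereal (32 * (8 * alpha_star \<alpha> / 2 powr alpha_star \<alpha>) powr ((\<alpha> - 1) / (2 - \<alpha>)) *
                  (lq_norm 2 \<sigma> N / lq_norm (alpha_star \<alpha>) \<sigma> N) powr (\<alpha> / (2 - \<alpha>))))"

text \<open>The quantity \<open>min[\<gamma>\<^sup>2; g\<^sup>2\<^sup>-\<^sup>\<alpha> \<gamma>\<^sup>\<alpha>]\<close>, understood as \<open>\<gamma>\<^sup>2\<close> for \<open>g = \<infinity>\<close>.\<close>

definition tail_exponent :: "real \<Rightarrow> ereal \<Rightarrow> real \<Rightarrow> real" where
  "tail_exponent \<alpha> g \<gamma> =
     (if g = \<infinity> then \<gamma>\<^sup>2
      else min (\<gamma>\<^sup>2) (real_of_ereal g powr (2 - \<alpha>) * \<gamma> powr \<alpha>))"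

end

theory Submission
  imports Defs "HOL-Real_Asymp.Real_Asymp"
begin

text \<open>
  The norm is replaced by the envelope
  \<open>V x = min\<^sub>h (norm h + p (x - h)\<^sup>2 / (2 * \<beta>))\<close>, where \<open>p\<close> is the smooth norm
  that regularity provides.  It satisfies \<open>V 0 = 0\<close>, \<open>norm x \<le> V x + \<beta> / 2\<close>, it is 1-Lipschitz
  for the original norm, and it inherits from \<open>p\<close> the one-sided expansion
  \<open>V (x + y) \<le> V x + g x y + \<kappa> / (2 * \<beta>) * (norm y)\<^sup>2\<close> with \<open>g x\<close> linear
  (\<open>smooth_minorant_of_regular_norm\<close>).  Along the partial sums \<open>S\<^sub>i\<close>
  of the martingale-difference the increment \<open>D = V S\<^sub>i - V S\<^sub>i\<^sub>-\<^sub>1\<close> is thus bounded in two ways: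
  by \<open>norm \<xi>\<^sub>i\<close>, and by a term of conditional mean zero plus
  \<open>\<kappa> / (2 * \<beta>) * (norm \<xi>\<^sub>i)\<^sup>2\<close>.  The vector problem has become a scalar one in which the drift
  is of second order.

  The scalar part bounds \<open>exp (\<tau> * D)\<close> pointwise by an affine function of the mean-zero term and of
  \<open>exp ((norm \<xi>\<^sub>i / \<sigma>\<^sub>i) powr \<alpha>)\<close>, the two quantities whose conditional expectations are controlled.
  For \<open>\<alpha> = 2\<close> the inequality \<open>exp x \<le> x + exp (x\<^sup>2)\<close> gives the exponent
  \<open>\<tau> * \<kappa> / (2 * \<beta>) * \<sigma>\<^sub>i\<^sup>2 + (\<tau> * \<sigma>\<^sub>i)\<^sup>2\<close> for all \<open>\<tau> \<ge> 0\<close>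
  (\<open>affine_majorant_2\<close>).  For \<open>1 < \<alpha> < 2\<close> a second-order expansion serves for
  \<open>\<tau> * \<sigma>\<^sub>i \<le> 1 / 2\<close>; beyond that, Young's inequality costs a term of order
  \<open>(\<tau> * \<sigma>\<^sub>i) powr alpha_star \<alpha>\<close>, which is where the conjugate norm of the \<open>\<sigma>\<^sub>i\<close> enters
  (\<open>affine_majorant_powr\<close>).  For \<open>\<alpha> = 1\<close> this term degenerates into the constraint
  \<open>\<tau> * \<sigma>\<^sub>i \<le> 1\<close>, and the maximum norm takes over.

  Multiplying the conditional bounds along the filtration gives a Chernoff bound for \<open>V S\<^sub>N\<close>
  (\<open>chernoff_bound\<close>).  With \<open>s = sqrt (\<Sum>i. \<sigma>\<^sub>i\<^sup>2)\<close>, the loss \<open>\<beta> / 2\<close> and the total drift balance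
  at \<open>\<beta> = sqrt (A * \<kappa>) * s\<close>, where \<open>A\<close> is 1 or \<open>exp 1\<close>, and the choice of \<open>\<tau>\<close>
  yields the tails.  Differences bounded by \<open>\<sigma>\<^sub>i\<close> satisfy the exponential moment condition with
  \<open>\<alpha> = 2\<close>, and in that case the argument already gives the exponent \<open>- \<gamma>\<^sup>2 / 2\<close>.
\<close>

section \<open>Finite-dimensional normed spaces\<close>

text \<open>The distance from \<open>b\<close> to \<open>S\<close> serves as \<open>d\<close>: after division by \<open>c\<close> the vector
  \<open>s + c *\<^sub>R b\<close> becomes the difference of \<open>b\<close> and a point of \<open>S\<close>.  This makes the coefficient of a new
  basis vector a continuous function, which drives the inductions on the dimension below.\<close>

lemma coefficient_bound_off_closed_subspace:
  fixes S :: "'a::real_normed_vector set"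
  assumes "subspace S" "closed S" "b \<notin> S"
  obtains d where "d > 0" "\<And>s c. s \<in> S \<Longrightarrow> \<bar>c\<bar> * d \<le> norm (s + c *\<^sub>R b)"
proof
  show "infdist b S > 0"
    using assms in_closed_iff_infdist_zero[of S b] infdist_nonneg[of b S] subspace_0[of S]
    by fastforce
  fix s c assume s: "s \<in> S"
  show "\<bar>c\<bar> * infdist b S \<le> norm (s + c *\<^sub>R b)"
  proof (cases "c = 0")
    case False
    have "- (inverse c *\<^sub>R s) \<in> S"
      using assms(1) s by (simp add: subspace_neg subspace_scale)
    then have "infdist b S \<le> norm (b + inverse c *\<^sub>R s)"
      using infdist_le[of _ S b] by (fastforce simp: dist_norm)
    then have "\<bar>c\<bar> * infdist b S \<le> norm (c *\<^sub>R (b + inverse c *\<^sub>R s))"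
      by (simp add: mult_left_mono)
    also have "c *\<^sub>R (b + inverse c *\<^sub>R s) = s + c *\<^sub>R b"
      using False by (simp add: scaleR_right_distrib add.commute)
    finally show ?thesis .
  qed simp
qed

text \<open>If \<open>b\<close> is added to a closed span, the \<open>b\<close>-coefficients of a convergent sequence
  form a Cauchy sequence, so both parts of the sequence converge.\<close>

lemma closed_span_finite:
  fixes B :: "'a::real_normed_vector set"
  assumes "finite B"
  shows "closed (span B)"
  using assms
proof (induction B)
  case (insert b B)
  show ?case
  proof (cases "b \<in> span B")
    case True
    then show ?thesis using insert.IH by (simp add: span_redundant)
  next
    case False
    obtain d where d: "d > 0" "\<And>s c. s \<in> span B \<Longrightarrow> \<bar>c\<bar> * d \<le> norm (s + c *\<^sub>R b)"
      using coefficient_bound_off_closed_subspace[OF subspace_span insert.IH False] by blast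
    show ?thesis
      unfolding closed_sequential_limits
    proof (intro allI impI)
      fix z l assume z: "(\<forall>n. z n \<in> span (insert b B)) \<and> z \<longlonglongrightarrow> l"
      then obtain k where k: "\<And>n. z n - k n *\<^sub>R b \<in> span B"
        unfolding span_breakdown_eq using choice[of "\<lambda>n k. z n - k *\<^sub>R b \<in> span B"] by auto
      have close: "\<bar>k m - k n\<bar> * d \<le> norm (z m - z n)" for m n
        using d(2)[OF span_diff[OF k[of m] k[of n]], of "k m - k n"]
        by (simp add: algebra_simps)
      have "Cauchy k"
      proof (rule metric_CauchyI)
        fix e :: real assume "e > 0"
        then have "e * d > 0" using d(1) by simp
        moreover have "Cauchy z" using z by (intro LIMSEQ_imp_Cauchy) auto
        ultimately obtain M where M: "\<And>m n. m \<ge> M \<Longrightarrow> n \<ge> M \<Longrightarrow> dist (z m) (z n) < e * d"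
          using metric_CauchyD by blast
        have "dist (k m) (k n) < e" if "m \<ge> M" "n \<ge> M" for m n
        proof -
          have "\<bar>k m - k n\<bar> * d < e * d"
            using close[of m n] M[OF that] by (simp add: dist_norm)
          then show ?thesis using d(1) by (simp add: dist_real_def)
        qed
        then show "\<exists>M. \<forall>m\<ge>M. \<forall>n\<ge>M. dist (k m) (k n) < e" by blast
      qed
      then obtain c where c: "k \<longlonglongrightarrow> c"
        using real_Cauchy_convergent[of k] unfolding convergent_def by auto
      have "(\<lambda>n. z n - k n *\<^sub>R b) \<longlonglongrightarrow> l - c *\<^sub>R b"
        by (rule tendsto_diff[OF conjunct2[OF z] tendsto_scaleR[OF c tendsto_const]])
      then have "l - c *\<^sub>R b \<in> span B"
        by (rule closed_sequentially[OF insert.IH, rotated]) (rule k)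
      then show "l \<in> span (insert b B)" unfolding span_breakdown_eq by blast
    qed
  qed
qed simp

text \<open>Adding \<open>b\<close> keeps the ball inside the sum of a smaller-dimensional ball and a segment,
  because the coefficient of \<open>b\<close> is bounded.\<close>

lemma compact_cball_Int_span_finite:
  fixes B :: "'a::real_normed_vector set"
  assumes "finite B"
  shows "compact (cball 0 R \<inter> span B)"
  using assms
proof (induction B arbitrary: R)
  case empty
  have "compact ({0 :: 'a} \<inter> cball 0 R)" by (intro compact_Int_closed) auto
  then show ?case by (simp only: span_empty Int_commute)
next
  case (insert b B)
  show ?case
  proof (cases "b \<in> span B")
    case True
    then show ?thesis using insert.IH by (simp add: span_redundant)
  next
    case False
    obtain d where d: "d > 0" "\<And>s c. s \<in> span B \<Longrightarrow> \<bar>c\<bar> * d \<le> norm (s + c *\<^sub>R b)"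
      using coefficient_bound_off_closed_subspace[OF subspace_span
          closed_span_finite[OF insert.hyps(1)] False] by blast
    define K where "K = (\<lambda>c. c *\<^sub>R b) ` {- (R / d)..R / d}"
    define L where "L = cball 0 (R + R / d * norm b) \<inter> span B"
    have "compact {x + y |x y. x \<in> L \<and> y \<in> K}"
      unfolding K_def L_def
      by (intro compact_sums insert.IH compact_continuous_image continuous_intros) auto
    moreover have "cball 0 R \<inter> span (insert b B) \<subseteq> {x + y |x y. x \<in> L \<and> y \<in> K}"
    proof
      fix x assume x: "x \<in> cball 0 R \<inter> span (insert b B)"
      then obtain c where c: "x - c *\<^sub>R b \<in> span B"
        using span_breakdown_eq[of x b B] by auto
      have "\<bar>c\<bar> * d \<le> R" using d(2)[OF c, of c] x by simp
      then have cR: "\<bar>c\<bar> \<le> R / d" using d(1) by (simp add: pos_le_divide_eq)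
      have "norm (x - c *\<^sub>R b) \<le> norm x + \<bar>c\<bar> * norm b"
        using norm_triangle_ineq4[of x "c *\<^sub>R b"] by simp
      also have "\<dots> \<le> R + R / d * norm b"
        using x cR by (intro add_mono mult_right_mono) auto
      finally have "x - c *\<^sub>R b \<in> L" using c by (simp add: L_def)
      moreover have "c *\<^sub>R b \<in> K" unfolding K_def using cR by (intro imageI) auto
      moreover have "x = (x - c *\<^sub>R b) + c *\<^sub>R b" by simp
      ultimately show "x \<in> {x + y |x y. x \<in> L \<and> y \<in> K}"
        by (intro CollectI exI[of _ "x - c *\<^sub>R b"] exI[of _ "c *\<^sub>R b"] conjI)
    qed
    moreover have "closed (cball 0 R \<inter> span (insert b B))"
      using closed_span_finite[of "insert b B"] insert.hyps by (intro closed_Int) auto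
    ultimately show ?thesis
      using compact_Int_closed[of "{x + y |x y. x \<in> L \<and> y \<in> K}" "cball 0 R \<inter> span (insert b B)"]
      by (simp add: Int_absorb1)
  qed
qed

text \<open>Bounded coordinate functionals reduce statements about vector-valued conditional
  expectations to scalar ones.\<close>

lemma finite_dim_coordinates:
  fixes B0 :: "'a::real_normed_vector set"
  assumes "finite B0" "span B0 = UNIV"
  obtains B :: "'a set" and c :: "'a \<Rightarrow> 'a \<Rightarrow> real" where "finite B"
    "\<And>b. b \<in> B \<Longrightarrow> bounded_linear (c b)" "\<And>x. x = (\<Sum>b\<in>B. c b x *\<^sub>R b)"
proof -
  obtain B where B: "B \<subseteq> B0" "independent B" "B0 \<subseteq> span B"
    using maximal_independent_subset by blast
  have fin: "finite B" using B(1) assms(1) finite_subset by blast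
  have sp: "span B = UNIV" using B(3) assms(2) by (metis span_mono span_span top.extremum_uniqueI)
  define c where "c b x = representation B x b" for b x
  have eq: "x = (\<Sum>b\<in>B. c b x *\<^sub>R b)" for x
    unfolding c_def using real_vector.sum_representation_eq[OF B(2) _ fin order.refl, of x] sp by simp
  have "bounded_linear (c b)" if b: "b \<in> B" for b
  proof -
    have "b \<notin> span (B - {b})" using B(2) b dependent_def by blast
    then obtain d where d: "d > 0"
      "\<And>s k. s \<in> span (B - {b}) \<Longrightarrow> \<bar>k\<bar> * d \<le> norm (s + k *\<^sub>R b)"
      using coefficient_bound_off_closed_subspace[OF subspace_span closed_span_finite] fin
      by (metis finite_Diff)
    have "norm (c b x) \<le> norm x * (1 / d)" for x
    proof -
      have "x = (\<Sum>b'\<in>B - {b}. c b' x *\<^sub>R b') + c b x *\<^sub>R b"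
        using eq[of x] sum.remove[OF fin b, of "\<lambda>b. c b x *\<^sub>R b"] by (simp add: add.commute)
      moreover have "(\<Sum>b'\<in>B - {b}. c b' x *\<^sub>R b') \<in> span (B - {b})"
        by (intro span_sum span_scale span_base)
      ultimately have "\<bar>c b x\<bar> * d \<le> norm x" using d(2) by metis
      then show ?thesis using d(1) by (simp add: field_simps)
    qed
    moreover have "c b (x + y) = c b x + c b y" "c b (r *\<^sub>R x) = r *\<^sub>R c b x" for x y r
      unfolding c_def using sp B(2)
      by (simp_all add: real_vector.representation_add real_vector.representation_scale)
    ultimately show ?thesis using bounded_linear_intro[of "c b" "1 / d"] by blast
  qed
  then show ?thesis using that fin eq by blast
qed

section \<open>A smooth minorant of a regular norm\<close>

text \<open>The minimiser \<open>H x\<close> of the infimal convolution exists by compactness.  Inserting \<open>H x\<close>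
  as a competitor at \<open>x + y\<close> transfers the upper expansion of \<open>p\<^sup>2\<close> to \<open>V\<close>, with constant
  \<open>\<kappa>p * (p y)\<^sup>2 \<le> \<kappa> * (norm y)\<^sup>2\<close>; inserting \<open>H x + y\<close> gives the Lipschitz bound.  Since \<open>V\<close> is also
  convex, the upper expansion is two-sided, so \<open>g x\<close> is the derivative of \<open>V\<close>: it is a limit of difference
  quotients, hence bounded by the norm and Borel measurable in \<open>x\<close> whatever minimisers were chosen.\<close>

lemma smooth_minorant_of_regular_norm:
  fixes B0 :: "'e::real_normed_vector set"
  assumes fin: "finite B0" "span B0 = UNIV"
    and reg: "kappa_regular \<kappa> (norm :: 'e \<Rightarrow> real)" and beta: "\<beta> > 0"
  obtains V :: "'e \<Rightarrow> real" and g :: "'e \<Rightarrow> 'e \<Rightarrow> real"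
  where "V 0 = 0" "\<And>x. norm x \<le> V x + \<beta> / 2"
    "\<And>x y. \<bar>V (x + y) - V x\<bar> \<le> norm y"
    "\<And>x y. V (x + y) \<le> V x + g x y + \<kappa> / (2 * \<beta>) * (norm y)\<^sup>2"
    "\<And>x. linear (g x)" "\<And>x y. \<bar>g x y\<bar> \<le> norm y"
    "\<And>y. (\<lambda>x. g x y) \<in> borel_measurable borel"
proof -
  obtain \<kappa>p p where kp: "1 \<le> \<kappa>p" "\<kappa>p \<le> \<kappa>" and nrm: "is_norm p" and sm: "kappa_smooth \<kappa>p p"
    and cmp: "\<And>x :: 'e. (norm x)\<^sup>2 \<le> (p x)\<^sup>2" "\<And>x. (p x)\<^sup>2 \<le> \<kappa> / \<kappa>p * (norm x)\<^sup>2"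
    using reg unfolding kappa_regular_def by blast
  obtain D :: "'e \<Rightarrow> 'e \<Rightarrow>\<^sub>L real" where
    der: "\<And>x. ((\<lambda>z. (p z)\<^sup>2) has_derivative blinfun_apply (D x)) (at x)" and
    up: "\<And>x y. (p (x + y))\<^sup>2 \<le> (p x)\<^sup>2 + blinfun_apply (D x) y + \<kappa>p * (p y)\<^sup>2"
    using sm unfolding kappa_smooth_def by blast
  have p0: "p 0 = 0" and psc: "\<And>c x. p (c *\<^sub>R x) = \<bar>c\<bar> * p x" and ptri: "\<And>x y. p (x + y) \<le> p x + p y"
    using nrm unfolding is_norm_def by auto
  have pge: "p x \<ge> 0" for x
    using ptri[of x "-x"] psc[of "-1" x] p0 by simp
  have norm_le_p: "norm x \<le> p x" for x
    using cmp(1)[of x] pge power2_le_imp_le by blast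
  have p2: "\<kappa>p * (p y)\<^sup>2 \<le> \<kappa> * (norm y)\<^sup>2" for y
    using mult_left_mono[OF cmp(2)[of y], of \<kappa>p] kp by (simp add: field_simps)
  define J where "J x h = norm h + (p (x - h))\<^sup>2 / (2 * \<beta>)" for x h
  have contp2: "continuous_on UNIV (\<lambda>z. (p z)\<^sup>2)"
    by (intro continuous_at_imp_continuous_on ballI has_derivative_continuous[OF der])
  have contJ: "continuous_on A (J x)" for x A
  proof -
    have "continuous_on A (\<lambda>h. x - h)" by (intro continuous_intros)
    then have "continuous_on A (\<lambda>h. (p (x - h))\<^sup>2)"
      by (rule continuous_on_compose2[OF contp2]) auto
    then show ?thesis unfolding J_def divide_inverse by (intro continuous_on_add continuous_on_mult continuous_on_norm continuous_on_id continuous_on_const)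
  qed
  have "\<exists>h. \<forall>h'. J x h \<le> J x h'" for x
  proof -
    (* outside this ball the first summand alone exceeds J x x *)
    have "compact (cball 0 (norm x) :: 'e set)"
      using compact_cball_Int_span_finite[OF fin(1), of "norm x"] fin(2) by simp
    from continuous_attains_inf[OF this _ contJ[of "cball 0 (norm x)" x]]
    obtain h where "\<forall>h' \<in> cball 0 (norm x). J x h \<le> J x h'" by auto
    then have h: "\<And>h'. norm h' \<le> norm x \<Longrightarrow> J x h \<le> J x h'" by simp
    have "J x h \<le> J x h'" if "\<not> norm h' \<le> norm x" for h'
    proof -
      have "J x h \<le> J x x" by (rule h) simp
      also have "\<dots> \<le> norm h'" using that by (simp add: J_def p0)
      also have "\<dots> \<le> J x h'" using beta by (simp add: J_def)
      finally show ?thesis .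
    qed
    then have "J x h \<le> J x h'" for h'
      using h[of h'] by (cases "norm h' \<le> norm x") auto
    then show ?thesis by blast
  qed
  then have "\<exists>H. \<forall>x h. J x (H x) \<le> J x h" by (intro choice) simp
  then obtain H where H: "\<And>x h. J x (H x) \<le> J x h" by auto
  define V where "V x = J x (H x)" for x
  define g where "g x y = blinfun_apply (D (x - H x)) y / (2 * \<beta>)" for x y
  have V0: "V 0 = 0"
  proof (rule antisym)
    show "V 0 \<le> 0" using H[of 0 0] by (simp add: V_def J_def p0)
    show "0 \<le> V 0" using beta by (simp add: V_def J_def)
  qed
  have lower: "norm x \<le> V x + \<beta> / 2" for x
  proof -
    have "2 * \<beta> * norm (x - H x) \<le> 2 * \<beta> * p (x - H x)"
      using norm_le_p beta by (intro mult_left_mono) auto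
    also have "\<dots> \<le> (p (x - H x))\<^sup>2 + \<beta>\<^sup>2"
      using sum_squares_bound[of \<beta> "p (x - H x)"] by simp
    finally have "norm (x - H x) \<le> (p (x - H x))\<^sup>2 / (2 * \<beta>) + \<beta> / 2"
      using beta by (simp add: field_simps power2_eq_square)
    then show ?thesis
      using norm_triangle_ineq[of "H x" "x - H x"] by (simp add: V_def J_def)
  qed
  have lip: "V (x + y) \<le> V x + norm y" for x y
    using H[of "x + y" "H x + y"] norm_triangle_ineq[of "H x" y] by (simp add: V_def J_def)
  have lip2: "\<bar>V (x + y) - V x\<bar> \<le> norm y" for x y
    using lip[of x y] lip[of "x + y" "- y"] by simp
  have upper: "V (x + y) \<le> V x + g x y + \<kappa> / (2 * \<beta>) * (norm y)\<^sup>2" for x y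
  proof -
    have "V (x + y) \<le> J (x + y) (H x)" unfolding V_def by (rule H)
    also have "\<dots> = norm (H x) + (p ((x - H x) + y))\<^sup>2 / (2 * \<beta>)"
      by (simp add: J_def algebra_simps)
    also have "\<dots> \<le> norm (H x) + ((p (x - H x))\<^sup>2 + D (x - H x) y + \<kappa> * (norm y)\<^sup>2) / (2 * \<beta>)"
      using up[of "x - H x" y] p2[of y] beta by (intro add_left_mono divide_right_mono) auto
    also have "\<dots> = V x + g x y + \<kappa> / (2 * \<beta>) * (norm y)\<^sup>2"
      by (simp add: V_def J_def g_def add_divide_distrib)
    finally show ?thesis .
  qed
  have lin: "linear (g x)" for x
    unfolding g_def by (intro linearI) (auto simp: blinfun.add_right blinfun.scaleR_right add_divide_distrib)
  have convex: "2 * V x \<le> V (x + y) + V (x - y)" for x y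
  proof -
    define u v where "u = x + y - H (x + y)" and "v = x - y - H (x - y)"
    have "p (u + v) \<le> p u + p v" by (rule ptri)
    then have "(p (u + v))\<^sup>2 \<le> (p u + p v)\<^sup>2" using pge by (intro power_mono) auto
    also have "\<dots> \<le> 2 * ((p u)\<^sup>2 + (p v)\<^sup>2)"
      using sum_squares_bound[of "p u" "p v"] by (simp add: power2_sum)
    finally have 1: "(p ((1/2) *\<^sub>R (u + v)))\<^sup>2 \<le> ((p u)\<^sup>2 + (p v)\<^sup>2) / 2"
      by (simp add: psc power_mult_distrib power_divide)
    define h where "h = (1/2) *\<^sub>R (H (x + y) + H (x - y))"
    have "x - h = (1/2) *\<^sub>R (u + v)"
      by (simp add: h_def u_def v_def algebra_simps flip: scaleR_left_distrib)
    then have "(p (x - h))\<^sup>2 / (2 * \<beta>) \<le> (((p u)\<^sup>2 + (p v)\<^sup>2) / 2) / (2 * \<beta>)"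
      using 1 beta by (intro divide_right_mono) auto
    moreover have "norm h \<le> (norm (H (x + y)) + norm (H (x - y))) / 2"
      using norm_triangle_ineq[of "H (x + y)" "H (x - y)"] by (simp add: h_def)
    ultimately have "2 * J x h \<le> V (x + y) + V (x - y)"
      by (simp add: J_def V_def u_def v_def add_divide_distrib)
    then show ?thesis using H[of x h] by (simp add: V_def)
  qed
  (* apply the upper expansion at - y and convert it by convexity into a lower one at y *)
  have diffV: "\<bar>V (x + y) - V x - g x y\<bar> \<le> \<kappa> / (2 * \<beta>) * (norm y)\<^sup>2" for x y
    using upper[of x y] upper[of x "- y"] convex[of x y] linear_neg[OF lin[of x], of y] by simp
  have lim: "(\<lambda>n. real (Suc n) * (V (x + y /\<^sub>R real (Suc n)) - V x)) \<longlonglongrightarrow> g x y" for x y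
  proof -
    define C where "C = \<kappa> / (2 * \<beta>) * (norm y)\<^sup>2"
    have bound: "\<bar>k * (V (x + y /\<^sub>R k) - V x) - g x y\<bar> \<le> C * inverse k" if k: "k > 0" for k
    proof -
      have g1: "g x (y /\<^sub>R k) = g x y / k"
        using linear_scale[OF lin[of x], of "inverse k" y] by (simp add: divide_inverse mult.commute)
      have n1: "(norm (y /\<^sub>R k))\<^sup>2 = (norm y)\<^sup>2 / k\<^sup>2"
        using k by (simp add: power_mult_distrib power_inverse divide_inverse mult.commute)
      have "\<bar>V (x + y /\<^sub>R k) - V x - g x y / k\<bar> \<le> C / k\<^sup>2"
        using diffV[of x "y /\<^sub>R k"] unfolding g1 n1 C_def by (simp only: times_divide_eq_right)
      then have "k * \<bar>V (x + y /\<^sub>R k) - V x - g x y / k\<bar> \<le> k * (C / k\<^sup>2)"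
        using k by (intro mult_left_mono) auto
      also have "k * (C / k\<^sup>2) = C * inverse k"
        using k by (simp add: divide_inverse power2_eq_square)
      also have "k * \<bar>V (x + y /\<^sub>R k) - V x - g x y / k\<bar> = \<bar>k * (V (x + y /\<^sub>R k) - V x - g x y / k)\<bar>"
        using k by (simp add: abs_mult)
      also have "k * (V (x + y /\<^sub>R k) - V x - g x y / k) = k * (V (x + y /\<^sub>R k) - V x) - g x y"
        using k by (simp add: right_diff_distrib)
      finally show ?thesis .
    qed
    have "(\<lambda>n. C * inverse (real (Suc n))) \<longlonglongrightarrow> 0"
      by (rule tendsto_mult_right_zero[OF LIMSEQ_inverse_real_of_nat])
    then have "(\<lambda>n. real (Suc n) * (V (x + y /\<^sub>R real (Suc n)) - V x) - g x y) \<longlonglongrightarrow> 0"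
      by (rule Lim_null_comparison[rotated])
         (rule always_eventually, unfold real_norm_def, intro allI bound, simp only: of_nat_0_less_iff zero_less_Suc)
    then show ?thesis by (rule LIM_zero_cancel)
  qed
  have gb: "\<bar>g x y\<bar> \<le> norm y" for x y
  proof (rule LIMSEQ_le_const2[OF tendsto_rabs[OF lim]])
    have "\<bar>real (Suc n) * (V (x + y /\<^sub>R real (Suc n)) - V x)\<bar> \<le> norm y" for n
    proof -
      define k where "k = real (Suc n)"
      have k: "k > 0" by (simp add: k_def)
      have "\<bar>V (x + y /\<^sub>R k) - V x\<bar> \<le> inverse k * norm y"
        using lip2[of x "y /\<^sub>R k"] k by simp
      then have "k * \<bar>V (x + y /\<^sub>R k) - V x\<bar> \<le> k * (inverse k * norm y)"
        using k by (intro mult_left_mono) auto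
      also have "k * (inverse k * norm y) = norm y" using k by simp
      finally show ?thesis using k unfolding k_def[symmetric] abs_mult by (simp only: abs_of_pos)
    qed
    then show "\<exists>N. \<forall>n\<ge>N. \<bar>real (Suc n) * (V (x + y /\<^sub>R real (Suc n)) - V x)\<bar> \<le> norm y" by blast
  qed
  have contV: "continuous_on UNIV V"
  proof (rule lipschitz_on_continuous_on[where L = 1], rule lipschitz_onI)
    show "dist (V x) (V y) \<le> 1 * dist x y" for x y
      using lip2[of y "x - y"] by (simp add: dist_norm)
  qed auto
  have meas: "(\<lambda>x. g x y) \<in> borel_measurable borel" for y
  proof (rule borel_measurable_LIMSEQ_real[OF lim])
    show "(\<lambda>x. real (Suc n) * (V (x + y /\<^sub>R real (Suc n)) - V x)) \<in> borel_measurable borel" for n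
      by (intro borel_measurable_continuous_onI continuous_intros
          continuous_on_compose2[OF contV]) auto
  qed
  show ?thesis by (rule that[of V g]) (fact V0 lower lip2 upper lin gb meas)+
qed

section \<open>Scalar exponential inequalities\<close>

lemma exp_le_quadratic:
  fixes x :: real
  assumes "x \<le> 1"
  shows "exp x \<le> 1 + x + x\<^sup>2"
proof (cases "x \<ge> 0")
  case True
  then show ?thesis using exp_bound assms by blast
next
  case False
  define y where "y = - x"
  have y: "y > 0" using False by (simp add: y_def)
  (* the product is 1 + y ^ 3 *)
  have "1 \<le> (1 + y) * (1 - y + y\<^sup>2)"
    using y by (simp add: algebra_simps power2_eq_square)
  also have "\<dots> \<le> exp y * (1 - y + y\<^sup>2)"
    using zero_le_power2[of "y - 1 / 2"]
    by (intro mult_right_mono exp_ge_add_one_self) (simp add: power2_eq_square algebra_simps)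
  finally have "exp (- y) \<le> exp (- y) * (exp y * (1 - y + y\<^sup>2))" by simp
  also have "\<dots> = 1 - y + y\<^sup>2" by (simp add: exp_minus)
  finally show ?thesis by (simp add: y_def)
qed

lemma exp_le_self_plus_exp_square:
  fixes x :: real
  shows "exp x \<le> x + exp (x\<^sup>2)"
proof (cases "x \<le> 1")
  case True
  then show ?thesis
    using exp_le_quadratic[of x] exp_ge_add_one_self[of "x\<^sup>2"] by linarith
next
  case False
  then have "x * 1 \<le> x * x" by (intro mult_left_mono) auto
  then have "exp x \<le> exp (x\<^sup>2)" by (simp add: power2_eq_square)
  then show ?thesis using False by linarith
qed

lemma exp_le_linear_plus_square_exp_abs:
  fixes x :: real
  shows "exp x \<le> 1 + x + x\<^sup>2 * exp \<bar>x\<bar>"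
proof (cases "x \<ge> 0")
  case True
  have "1 - x \<le> exp (- x)" using exp_ge_add_one_self[of "- x"] by simp
  then have "exp x * (1 - x) \<le> exp x * exp (- x)" by (intro mult_left_mono) auto
  then have *: "exp x - 1 \<le> x * exp x" by (simp add: exp_minus algebra_simps)
  have "x \<le> exp x - 1" using exp_ge_add_one_self[of x] by linarith
  then have "exp x - 1 - x \<le> x * (exp x - 1)" using * by (simp add: algebra_simps)
  also have "\<dots> \<le> x * (x * exp x)" using * True by (intro mult_left_mono)
  finally show ?thesis using True by (simp add: power2_eq_square)
next
  case False
  have "x\<^sup>2 * 1 \<le> x\<^sup>2 * exp \<bar>x\<bar>" by (intro mult_left_mono) auto
  then show ?thesis using exp_le_quadratic[of x] False by linarith
qed

lemma exp_mult_le_interpolation: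
  fixes w :: real
  assumes "0 \<le> \<theta>" "\<theta> \<le> 1"
  shows "exp (\<theta> * w) \<le> 1 - \<theta> + \<theta> * exp w"
  using convex_onD[OF exp_convex, of \<theta> 0 w] assms by (simp add: algebra_simps)

text \<open>Young's inequality for \<open>x\<close> and \<open>\<mu> / \<alpha>\<close>, multiplied by \<open>\<alpha>\<close> so that the power of \<open>x\<close>
  has coefficient one.\<close>

lemma mult_le_powr_plus_conjugate_powr:
  fixes x \<mu> \<alpha> :: real
  assumes "1 < \<alpha>" "0 \<le> x" "0 \<le> \<mu>"
  shows "\<mu> * x \<le> x powr \<alpha> + (\<alpha> - 1) * (\<mu> / \<alpha>) powr (\<alpha> / (\<alpha> - 1))"
proof -
  define q where "q = \<alpha> / (\<alpha> - 1)"
  have q: "q > 1" "1 / \<alpha> + 1 / q = 1" "\<alpha> / q = \<alpha> - 1"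
    using assms(1) by (auto simp: q_def field_simps)
  have "x * (\<mu> / \<alpha>) \<le> x powr \<alpha> / \<alpha> + (\<mu> / \<alpha>) powr q / q"
    using assms q by (intro Youngs_inequality) auto
  then have "\<alpha> * (x * (\<mu> / \<alpha>)) \<le> \<alpha> * (x powr \<alpha> / \<alpha> + (\<mu> / \<alpha>) powr q / q)"
    using assms(1) by (intro mult_left_mono) auto
  also have "\<dots> = x powr \<alpha> + (\<alpha> / q) * (\<mu> / \<alpha>) powr q"
    using assms(1) by (simp add: algebra_simps)
  finally show ?thesis using assms(1) q(3) by (simp add: q_def mult.commute)
qed

text \<open>For \<open>x \<ge> 1\<close> the right-hand side is at least \<open>16 * exp (x - 2)\<close>, and
  \<open>x\<^sup>2 \<le> 16 * exp (x / 2 - 2)\<close> is sharp at \<open>x = 4\<close>, which explains the constant.\<close>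

lemma square_exp_half_le_exp_powr:
  fixes x \<alpha> :: real
  assumes "1 \<le> \<alpha>" "0 \<le> x"
  shows "x\<^sup>2 * exp (x / 2) \<le> 16 * exp (- 2) * exp (x powr \<alpha>)"
proof (cases "x \<le> 1")
  case True
  have "x\<^sup>2 * exp (x / 2) \<le> 1 * exp (1 / 2)"
    using True assms(2) by (intro mult_mono) (auto simp: power_le_one)
  also have "\<dots> \<le> 16 * exp (- 2) * 1"
  proof -
    have "exp (5 / 2 :: real) \<le> 16"
    proof -
      have "exp (5 / 2 :: real) = exp 1 ^ 2 * exp (1 / 2)"
        by (simp flip: exp_of_nat_mult exp_add)
      also have "\<dots> \<le> 3 ^ 2 * (1 + 1/2 + (1/2)\<^sup>2)"
        using exp_le by (intro mult_mono power_mono exp_bound) auto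
      also have "\<dots> \<le> 16" by (simp add: power2_eq_square)
      finally show ?thesis .
    qed
    then have "exp (5 / 2) * exp (- 2) \<le> 16 * exp (- 2 :: real)" by (intro mult_right_mono) auto
    then show ?thesis by (simp flip: exp_add)
  qed
  also have "\<dots> \<le> 16 * exp (- 2) * exp (x powr \<alpha>)"
    by (intro mult_left_mono) auto
  finally show ?thesis by simp
next
  case False
  have "x / 4 \<le> exp (x / 4 - 1)" using exp_ge_add_one_self[of "x / 4 - 1"] by simp
  then have "(x / 4)\<^sup>2 \<le> exp (x / 4 - 1) ^ 2" using assms(2) by (intro power_mono) auto
  also have "\<dots> = exp (x / 2 - 2)" by (simp flip: exp_of_nat_mult)
  finally have "x\<^sup>2 \<le> 16 * exp (x / 2 - 2)" by (simp add: power_divide)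
  then have "x\<^sup>2 * exp (x / 2) \<le> 16 * exp (x / 2 - 2) * exp (x / 2)" by (intro mult_right_mono) auto
  also have "\<dots> = 16 * exp (- 2) * exp x" by (simp flip: exp_add)
  also have "\<dots> \<le> 16 * exp (- 2) * exp (x powr \<alpha>)"
    using powr_mono[of 1 \<alpha> x] False assms by (intro mult_left_mono) auto
  finally show ?thesis .
qed

lemma square_le_exp_powr:
  fixes x \<alpha> :: real
  assumes "1 \<le> \<alpha>" "0 \<le> x"
  shows "x\<^sup>2 \<le> exp (x powr \<alpha>)"
proof (cases "x \<le> 1")
  case True
  then have "x\<^sup>2 \<le> 1" using assms(2) by (simp add: power_le_one)
  also have "1 \<le> exp (x powr \<alpha>)" by simp
  finally show ?thesis .
next
  case False
  have "x\<^sup>2 \<le> exp x"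
  proof -
    have "x \<le> exp (x / 2)"
    proof -
      have "0 \<le> (x / 2 - 1)\<^sup>2" by simp
      then have "x \<le> 1 + x / 2 + (x / 2)\<^sup>2 / 2"
        by (simp add: power2_eq_square algebra_simps)
      also have "\<dots> \<le> exp (x / 2)" using assms(2) by (intro exp_lower_Taylor_quadratic) auto
      finally show ?thesis .
    qed
    then have "x\<^sup>2 \<le> exp (x / 2) ^ 2" using assms(2) by (intro power_mono)
    then show ?thesis by (simp flip: exp_of_nat_mult)
  qed
  also have "exp x \<le> exp (x powr \<alpha>)" using powr_mono[of 1 \<alpha> x] False assms by simp
  finally show ?thesis .
qed

text \<open>In the application \<open>D\<close> is the increment of the minorant, \<open>\<eta>\<close> its part of conditional mean
  zero and \<open>s * x\<close> the norm of the difference.  A bound that is affine in \<open>\<eta>\<close> and in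
  \<open>exp (x powr \<alpha>)\<close> can be integrated conditionally: \<open>\<eta>\<close> disappears, the other term contributes at
  most \<open>exp 1\<close>, and \<open>exp c\<close> is what remains.\<close>

definition affine_majorant :: "real \<Rightarrow> real \<Rightarrow> real \<Rightarrow> real \<Rightarrow> real \<Rightarrow> bool" where
  "affine_majorant \<alpha> m \<tau> s c \<longleftrightarrow>
     (\<exists>l p q. 0 \<le> p \<and> 0 \<le> q \<and> p + q * exp 1 \<le> exp c \<and>
        (\<forall>x D \<eta>. 0 \<le> x \<and> \<bar>D\<bar> \<le> s * x \<and> D \<le> \<eta> + m * (s * x)\<^sup>2 \<longrightarrow>
           exp (\<tau> * D) \<le> l * \<eta> + p + q * exp (x powr \<alpha>)))"

text \<open>If \<open>\<tau> * s \<le> 1\<close>, then \<open>exp z \<le> z + exp (z\<^sup>2)\<close> at \<open>z = \<tau> * D\<close> leaves a power of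
  \<open>exp (x\<^sup>2)\<close> with exponent at most one, and the chord of the exponential makes it affine.  If \<open>\<tau> * s > 1\<close>,
  the crude bound \<open>\<tau> * s * x \<le> ((\<tau> * s)\<^sup>2 + x\<^sup>2) / 2\<close> suffices, because the constant
  \<open>1 / 2\<close> that the square root of \<open>exp (x\<^sup>2)\<close> costs is dominated by \<open>(\<tau> * s)\<^sup>2 / 2\<close>.\<close>

lemma affine_majorant_2:
  assumes "0 \<le> \<tau>" "0 \<le> m" "0 < s"
  shows "affine_majorant 2 m \<tau> s (\<tau> * m * s\<^sup>2 + (\<tau> * s)\<^sup>2)"
proof -
  define \<theta> where "\<theta> = (\<tau> * s)\<^sup>2"
  define a where "a = \<tau> * m * s\<^sup>2"
  have a: "a \<ge> 0" using assms by (simp add: a_def)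
  have \<theta>: "\<theta> \<ge> 0" by (simp add: \<theta>_def)
  (* bounds the power t of exp (x^2), in a form that gives exp t when exp (x^2) has mean exp 1 *)
  have chord: "exp (t * x\<^sup>2) \<le> exp t * (1 - t) + exp t * t * exp (- 1) * exp (x powr 2)"
    if "0 \<le> t" "t \<le> 1" "0 \<le> x" for t x :: real
  proof -
    have "exp (t * x\<^sup>2) = exp t * exp (t * (x\<^sup>2 - 1))" by (simp add: algebra_simps flip: exp_add)
    also have "\<dots> \<le> exp t * (1 - t + t * exp (x\<^sup>2 - 1))"
      using that by (intro mult_left_mono exp_mult_le_interpolation) auto
    also have "exp (x\<^sup>2 - 1) = exp (- 1) * exp (x powr 2)"
      using that(3) by (simp add: powr_numeral flip: exp_add)
    finally show ?thesis by (simp add: algebra_simps)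
  qed
  show ?thesis
  proof (cases "\<tau> * s \<le> 1")
    case True
    have \<theta>1: "\<theta> \<le> 1" using True assms by (simp add: \<theta>_def power_le_one)
    define p where "p = exp \<theta> * (1 - \<theta>)"
    define q where "q = a * exp (- 1) + exp \<theta> * \<theta> * exp (- 1)"
    have "0 \<le> p" "0 \<le> q" using a \<theta> \<theta>1 by (auto simp: p_def q_def)
    moreover have "p + q * exp 1 \<le> exp (a + \<theta>)"
    proof -
      have "p + q * exp 1 = exp \<theta> + 1 * a"
        by (simp add: p_def q_def algebra_simps flip: exp_add)
      also have "\<dots> \<le> exp \<theta> + exp \<theta> * a" using a \<theta> by (intro add_left_mono mult_right_mono) auto
      also have "\<dots> = exp \<theta> * (1 + a)" by (simp add: algebra_simps)
      also have "\<dots> \<le> exp \<theta> * exp a" by (intro mult_left_mono exp_ge_add_one_self) auto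
      finally show ?thesis by (simp add: exp_add mult.commute)
    qed
    moreover have "exp (\<tau> * D) \<le> \<tau> * \<eta> + p + q * exp (x powr 2)"
      if "0 \<le> x" "\<bar>D\<bar> \<le> s * x" "D \<le> \<eta> + m * (s * x)\<^sup>2" for x D \<eta>
    proof -
      have "(\<tau> * D)\<^sup>2 = \<tau>\<^sup>2 * \<bar>D\<bar>\<^sup>2" by (simp add: power_mult_distrib)
      also have "\<dots> \<le> \<tau>\<^sup>2 * (s * x)\<^sup>2" using that by (intro mult_left_mono power_mono) auto
      finally have sq: "(\<tau> * D)\<^sup>2 \<le> \<theta> * x\<^sup>2" by (simp add: \<theta>_def power_mult_distrib)
      have "x\<^sup>2 \<le> exp (x\<^sup>2 - 1)" using exp_ge_add_one_self[of "x\<^sup>2 - 1"] by simp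
      also have "\<dots> = exp (- 1) * exp (x powr 2)"
        using that(1) by (simp add: powr_numeral flip: exp_add)
      finally have x2: "a * x\<^sup>2 \<le> a * (exp (- 1) * exp (x powr 2))" using a by (rule mult_left_mono)
      have "exp (\<tau> * D) \<le> \<tau> * D + exp (\<theta> * x\<^sup>2)"
        using exp_le_self_plus_exp_square[of "\<tau> * D"] sq exp_le_cancel_iff[of "(\<tau> * D)\<^sup>2" "\<theta> * x\<^sup>2"]
        by linarith
      also have "\<tau> * D \<le> \<tau> * (\<eta> + m * (s * x)\<^sup>2)" using that assms by (intro mult_left_mono)
      also have "\<dots> = \<tau> * \<eta> + a * x\<^sup>2" by (simp add: a_def algebra_simps power_mult_distrib)
      finally show ?thesis
        using x2 chord[OF \<theta> \<theta>1 that(1)] by (simp add: p_def q_def algebra_simps)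
    qed
    ultimately show ?thesis unfolding affine_majorant_def a_def \<theta>_def by blast
  next
    case False
    define E where "E = exp (\<theta> / 2)"
    define p where "p = E * (exp (1/2) / 2)"
    define q where "q = E * (exp (1/2) / 2 * exp (- 1))"
    have "0 \<le> p" "0 \<le> q" by (auto simp: p_def q_def E_def)
    moreover have "p + q * exp 1 \<le> exp (a + \<theta>)"
    proof -
      have "1 \<le> \<theta>" using False by (simp add: \<theta>_def)
      have "p + q * exp 1 = exp (\<theta> / 2 + 1 / 2)"
        by (simp add: p_def q_def E_def algebra_simps flip: exp_add)
      also have "\<dots> \<le> exp (a + \<theta>)" using a \<open>1 \<le> \<theta>\<close> by simp
      finally show ?thesis .
    qed
    moreover have "exp (\<tau> * D) \<le> 0 * \<eta> + p + q * exp (x powr 2)"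
      if "0 \<le> x" "\<bar>D\<bar> \<le> s * x" for x D \<eta>
    proof -
      have "\<tau> * D \<le> \<tau> * (s * x)" using that assms by (intro mult_left_mono) auto
      also have "\<dots> \<le> \<theta> / 2 + 1/2 * x\<^sup>2"
        using sum_squares_bound[of "\<tau> * s" x] by (simp add: \<theta>_def algebra_simps)
      finally have "exp (\<tau> * D) \<le> E * exp (1/2 * x\<^sup>2)" by (simp add: E_def flip: exp_add)
      also have "\<dots> \<le> E * (exp (1/2) * (1 - 1/2) + exp (1/2) * (1/2) * exp (- 1) * exp (x powr 2))"
        using that by (intro mult_left_mono chord) (auto simp: E_def)
      finally show ?thesis by (simp add: p_def q_def algebra_simps)
    qed
    ultimately show ?thesis unfolding affine_majorant_def a_def \<theta>_def by blast
  qed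
qed

text \<open>For \<open>\<tau> * s \<le> 1 / 2\<close> the second-order remainder is controlled by \<open>exp (x powr \<alpha>)\<close> up to a
  constant.  For larger \<open>\<tau>\<close> the term \<open>7 * (\<tau> * s)\<^sup>2\<close> exceeds 1 and absorbs the factor \<open>exp 1\<close>
  that the moment condition contributes.\<close>

lemma affine_majorant_powr:
  assumes "1 \<le> \<alpha>" "0 \<le> \<tau>" "0 \<le> m" "0 < s" "0 \<le> b"
    and young: "\<And>x. 0 \<le> x \<Longrightarrow> \<tau> * s * x \<le> x powr \<alpha> + b"
  shows "affine_majorant \<alpha> m \<tau> s (exp 1 * \<tau> * m * s\<^sup>2 + 7 * (\<tau> * s)\<^sup>2 + b)"
proof -
  define \<mu> where "\<mu> = \<tau> * s"
  define a where "a = \<tau> * m * s\<^sup>2"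
  have a: "a \<ge> 0" using assms by (simp add: a_def)
  have \<mu>: "\<mu> \<ge> 0" using assms by (simp add: \<mu>_def)
  have bnd: "\<bar>\<tau> * D\<bar> \<le> \<mu> * x" if "\<bar>D\<bar> \<le> s * x" for D x
    using mult_left_mono[OF that assms(2)] assms(2) by (simp add: abs_mult \<mu>_def mult.assoc)
  show ?thesis
  proof (cases "\<mu> \<le> 1 / 2")
    case True
    define q where "q = a + \<mu>\<^sup>2 * (16 * exp (- 2))"
    have "0 \<le> q" using a by (simp add: q_def)
    moreover have "1 + q * exp 1 \<le> exp (exp 1 * a + 7 * \<mu>\<^sup>2 + b)"
    proof -
      have "16 * exp (- 1) \<le> (7 :: real)"
        using exp_lower_Taylor_quadratic[of "1::real"] by (simp add: exp_minus field_simps)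
      then have "\<mu>\<^sup>2 * (16 * exp (- 1)) \<le> \<mu>\<^sup>2 * 7" by (intro mult_left_mono) auto
      moreover have "exp (- 2) * exp 1 = exp (- 1 :: real)" by (simp flip: exp_add)
      then have "q * exp 1 = exp 1 * a + \<mu>\<^sup>2 * (16 * exp (- 1))"
        by (simp add: q_def distrib_left distrib_right mult_ac)
      ultimately have "1 + q * exp 1 \<le> 1 + (exp 1 * a + 7 * \<mu>\<^sup>2)" by simp
      also have "\<dots> \<le> exp (exp 1 * a + 7 * \<mu>\<^sup>2)" by (rule exp_ge_add_one_self)
      also have "\<dots> \<le> exp (exp 1 * a + 7 * \<mu>\<^sup>2 + b)" using assms by simp
      finally show ?thesis .
    qed
    moreover have "exp (\<tau> * D) \<le> \<tau> * \<eta> + 1 + q * exp (x powr \<alpha>)"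
      if "0 \<le> x" "\<bar>D\<bar> \<le> s * x" "D \<le> \<eta> + m * (s * x)\<^sup>2" for x D \<eta>
    proof -
      have "\<mu> * x \<le> 1 / 2 * x" using True that(1) by (rule mult_right_mono)
      then have half: "\<bar>\<tau> * D\<bar> \<le> x / 2" using bnd[OF that(2)] by simp
      have "(\<tau> * D)\<^sup>2 * exp \<bar>\<tau> * D\<bar> \<le> (\<mu> * x)\<^sup>2 * exp (x / 2)"
        using power_mono[OF bnd[OF that(2)], of 2] half by (intro mult_mono) auto
      also have "\<dots> = \<mu>\<^sup>2 * (x\<^sup>2 * exp (x / 2))" by (simp add: power_mult_distrib)
      also have "\<dots> \<le> \<mu>\<^sup>2 * (16 * exp (- 2) * exp (x powr \<alpha>))"
        using that assms by (intro mult_left_mono square_exp_half_le_exp_powr) auto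
      finally have 1: "(\<tau> * D)\<^sup>2 * exp \<bar>\<tau> * D\<bar> \<le> \<mu>\<^sup>2 * (16 * exp (- 2) * exp (x powr \<alpha>))" .
      have 2: "a * x\<^sup>2 \<le> a * exp (x powr \<alpha>)"
        using that assms a by (intro mult_left_mono square_le_exp_powr) auto
      have "\<tau> * D \<le> \<tau> * (\<eta> + m * (s * x)\<^sup>2)" using that assms by (intro mult_left_mono)
      also have "\<dots> = \<tau> * \<eta> + a * x\<^sup>2" by (simp add: a_def algebra_simps power_mult_distrib)
      finally show ?thesis
        using 1 2 exp_le_linear_plus_square_exp_abs[of "\<tau> * D"] by (simp add: q_def algebra_simps)
    qed
    ultimately show ?thesis
      unfolding affine_majorant_def a_def \<mu>_def
      by (intro exI[of _ \<tau>] exI[of _ 1] exI[of _ q]) (auto simp: mult.assoc)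
  next
    case False
    have "exp b * exp 1 \<le> exp (exp 1 * a + 7 * \<mu>\<^sup>2 + b)"
    proof -
      have "(1 / 2)\<^sup>2 \<le> \<mu>\<^sup>2" using False by (intro power_mono) auto
      moreover have "0 \<le> exp 1 * a" using a by simp
      ultimately show ?thesis by (simp add: power2_eq_square flip: exp_add)
    qed
    moreover have "exp (\<tau> * D) \<le> 0 * \<eta> + 0 + exp b * exp (x powr \<alpha>)"
      if "0 \<le> x" "\<bar>D\<bar> \<le> s * x" for x D \<eta>
      using bnd[OF that(2)] young[OF that(1)] by (simp add: \<mu>_def flip: exp_add)
    ultimately show ?thesis
      unfolding affine_majorant_def a_def \<mu>_def
      by (intro exI[of _ 0] exI[of _ 0] exI[of _ "exp b"]) (auto simp: mult.assoc)
  qed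
qed

section \<open>Conditional expectations\<close>

text \<open>Expanding \<open>\<xi>\<close> in coordinates turns \<open>g (S \<omega>) (\<xi> \<omega>)\<close> into a finite sum of products of a factor
  measurable for \<open>G\<close> and a scalar coordinate of conditional mean zero.\<close>

lemma cond_exp_linear_functional_zero:
  fixes \<xi> :: "'w \<Rightarrow> 'e::{banach, second_countable_topology}"
  assumes "prob_space M" "subalgebra M G"
    and fin: "finite B0" "span B0 = (UNIV :: 'e set)"
    and \<xi>: "has_cond_exp M G \<xi> (\<lambda>_. 0)" and S: "S \<in> borel_measurable G"
    and lin: "\<And>x. linear (g x)" and bnd: "\<And>x y. \<bar>g x y\<bar> \<le> norm y"
    and meas: "\<And>y. (\<lambda>x. g x y) \<in> borel_measurable (borel :: 'e measure)"
  shows "integrable M (\<lambda>\<omega>. g (S \<omega>) (\<xi> \<omega>))"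
    and "AE \<omega> in M. real_cond_exp M G (\<lambda>\<omega>. g (S \<omega>) (\<xi> \<omega>)) \<omega> = 0"
proof -
  interpret prob_space M by fact
  interpret finite_measure_subalgebra M G using assms(2) by unfold_locales
  obtain B and c :: "'e \<Rightarrow> 'e \<Rightarrow> real" where B: "finite B"
    and c: "\<And>b. b \<in> B \<Longrightarrow> bounded_linear (c b)" and eq: "\<And>x. x = (\<Sum>b\<in>B. c b x *\<^sub>R b)"
    using finite_dim_coordinates[OF fin] by blast
  have int\<xi>: "integrable M \<xi>" and int0: "\<And>A. A \<in> sets G \<Longrightarrow> set_lebesgue_integral M A \<xi> = 0"
    using \<xi> unfolding has_cond_exp_def by (auto simp: set_lebesgue_integral_def)
  have expand: "g (S \<omega>) (\<xi> \<omega>) = (\<Sum>b\<in>B. g (S \<omega>) b * c b (\<xi> \<omega>))" for \<omega>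
  proof -
    have "g (S \<omega>) (\<xi> \<omega>) = g (S \<omega>) (\<Sum>b\<in>B. c b (\<xi> \<omega>) *\<^sub>R b)" using eq[of "\<xi> \<omega>"] by simp
    also have "\<dots> = (\<Sum>b\<in>B. c b (\<xi> \<omega>) * g (S \<omega>) b)"
      by (simp add: linear_sum[OF lin] linear_scale[OF lin])
    finally show ?thesis by (simp add: mult.commute)
  qed
  have gS: "(\<lambda>\<omega>. g (S \<omega>) b) \<in> borel_measurable G" for b
    using measurable_compose[OF S meas[of b]] by simp
  have gSM: "(\<lambda>\<omega>. g (S \<omega>) b) \<in> borel_measurable M" for b
    by (rule measurable_from_subalg[OF subalg gS])
  have intc: "integrable M (\<lambda>\<omega>. c b (\<xi> \<omega>))" if "b \<in> B" for b
    by (rule integrable_bounded_linear[OF c[OF that] int\<xi>])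
  have intt: "integrable M (\<lambda>\<omega>. g (S \<omega>) b * c b (\<xi> \<omega>))" if b: "b \<in> B" for b
  proof (rule Bochner_Integration.integrable_bound[OF integrable_mult_right[OF intc[OF b], of "norm b"]])
    show "(\<lambda>\<omega>. g (S \<omega>) b * c b (\<xi> \<omega>)) \<in> borel_measurable M"
      using gSM[of b] borel_measurable_integrable[OF intc[OF b]] by (rule borel_measurable_times)
    show "AE x in M. norm (g (S x) b * c b (\<xi> x)) \<le> norm (norm b * c b (\<xi> x))"
      using bnd by (intro AE_I2) (simp add: abs_mult mult_right_mono)
  qed
  show int: "integrable M (\<lambda>\<omega>. g (S \<omega>) (\<xi> \<omega>))"
    unfolding expand by (rule Bochner_Integration.integrable_sum) (rule intt)
  have zero: "AE \<omega> in M. real_cond_exp M G (\<lambda>\<omega>. g (S \<omega>) b * c b (\<xi> \<omega>)) \<omega> = 0" if b: "b \<in> B" for b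
  proof -
    have "AE \<omega> in M. real_cond_exp M G (\<lambda>\<omega>. c b (\<xi> \<omega>)) \<omega> = 0"
    proof (rule real_cond_exp_charact)
      fix A assume A: "A \<in> sets G"
      then have AM: "A \<in> sets M" using subalg by (auto simp: subalgebra_def)
      interpret L: bounded_linear "c b" by (rule c[OF b])
      have "(\<integral>x\<in>A. c b (\<xi> x) \<partial>M) = (\<integral>x. c b (indicator A x *\<^sub>R \<xi> x) \<partial>M)"
        unfolding set_lebesgue_integral_def by (simp add: L.scaleR)
      also have "\<dots> = c b (\<integral>x\<in>A. \<xi> x \<partial>M)"
        unfolding set_lebesgue_integral_def
        by (rule integral_bounded_linear[OF c[OF b] integrable_mult_indicator[OF AM int\<xi>]])
      finally show "(\<integral>x\<in>A. c b (\<xi> x) \<partial>M) = (\<integral>x\<in>A. 0 \<partial>M)"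
        using int0[OF A] by (simp add: L.zero set_lebesgue_integral_def)
    qed (use intc[OF b] in auto)
    moreover have "AE \<omega> in M. real_cond_exp M G (\<lambda>\<omega>. g (S \<omega>) b * c b (\<xi> \<omega>)) \<omega>
        = g (S \<omega>) b * real_cond_exp M G (\<lambda>\<omega>. c b (\<xi> \<omega>)) \<omega>"
      by (rule real_cond_exp_mult[OF gS borel_measurable_integrable[OF intc[OF b]] intt[OF b]])
    ultimately show ?thesis by eventually_elim simp
  qed
  (* padding with 0 outside B makes every member of the family integrable *)
  define h where "h b = (\<lambda>\<omega>. if b \<in> B then g (S \<omega>) b * c b (\<xi> \<omega>) else 0)" for b
  have "AE \<omega> in M. real_cond_exp M G (\<lambda>\<omega>. \<Sum>b\<in>B. h b \<omega>) \<omega> = (\<Sum>b\<in>B. real_cond_exp M G (h b) \<omega>)"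
  proof (rule real_cond_exp_sum)
    show "integrable M (h b)" for b using intt[of b] by (cases "b \<in> B") (auto simp: h_def)
  qed
  moreover have "AE \<omega> in M. \<forall>b\<in>B. real_cond_exp M G (h b) \<omega> = 0"
    using zero by (intro AE_finite_allI[OF B]) (auto simp: h_def)
  moreover have "(\<lambda>\<omega>. \<Sum>b\<in>B. h b \<omega>) = (\<lambda>\<omega>. g (S \<omega>) (\<xi> \<omega>))"
    unfolding expand by (simp add: h_def)
  ultimately show "AE \<omega> in M. real_cond_exp M G (\<lambda>\<omega>. g (S \<omega>) (\<xi> \<omega>)) \<omega> = 0"
    by (auto elim: AE_mp)
qed

lemma nn_cond_exp_le_of_affine_majorant:
  assumes "prob_space M" "subalgebra M G" and maj: "affine_majorant \<alpha> m \<tau> s c"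
    and \<eta>: "integrable M \<eta>" "AE \<omega> in M. real_cond_exp M G \<eta> \<omega> = 0"
    and X: "X \<in> borel_measurable M" "\<And>\<omega>. 0 \<le> X \<omega>"
    and expX: "AE \<omega> in M. nn_cond_exp M G (\<lambda>\<omega>. ennreal (exp (X \<omega> powr \<alpha>))) \<omega> \<le> ennreal (exp 1)"
    and D: "D \<in> borel_measurable M" "\<And>\<omega>. \<bar>D \<omega>\<bar> \<le> s * X \<omega>"
      "\<And>\<omega>. D \<omega> \<le> \<eta> \<omega> + m * (s * X \<omega>)\<^sup>2"
  shows "AE \<omega> in M. nn_cond_exp M G (\<lambda>\<omega>. ennreal (exp (\<tau> * D \<omega>))) \<omega> \<le> ennreal (exp c)"
proof -
  interpret prob_space M by fact
  interpret finite_measure_subalgebra M G using assms(2) by unfold_locales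
  obtain l p q where pq: "0 \<le> p" "0 \<le> q" "p + q * exp 1 \<le> exp c"
    and dom: "\<And>x D \<eta>. 0 \<le> x \<Longrightarrow> \<bar>D\<bar> \<le> s * x \<Longrightarrow> D \<le> \<eta> + m * (s * x)\<^sup>2 \<Longrightarrow>
           exp (\<tau> * D) \<le> l * \<eta> + p + q * exp (x powr \<alpha>)"
    using maj unfolding affine_majorant_def by blast
  define Z f where "Z \<omega> = exp (X \<omega> powr \<alpha>)" and "f \<omega> = exp (\<tau> * D \<omega>)" for \<omega>
  have meas [measurable]: "Z \<in> borel_measurable M" "f \<in> borel_measurable M"
    unfolding Z_def f_def using X(1) D(1) by measurable
  have expZ: "AE \<omega> in M. nn_cond_exp M G (\<lambda>\<omega>. ennreal (Z \<omega>)) \<omega> \<le> ennreal (exp 1)"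
    using expX by (simp add: Z_def)
  have fle: "f \<omega> \<le> l * \<eta> \<omega> + p + q * Z \<omega>" for \<omega>
    unfolding f_def Z_def by (intro dom X D)
  have intZ: "integrable M Z"
  proof (rule integrableI_nonneg)
    have "(\<integral>\<^sup>+\<omega>. ennreal (Z \<omega>) \<partial>M) = (\<integral>\<^sup>+\<omega>. nn_cond_exp M G (\<lambda>\<omega>. ennreal (Z \<omega>)) \<omega> \<partial>M)"
      using nn_cond_exp_intg[of "\<lambda>_. 1" "\<lambda>\<omega>. ennreal (Z \<omega>)"] by simp
    also have "\<dots> \<le> (\<integral>\<^sup>+\<omega>. ennreal (exp 1) \<partial>M)" using expZ by (rule nn_integral_mono_AE)
    also have "\<dots> < \<infinity>" by (simp add: emeasure_space_1)
    finally show "(\<integral>\<^sup>+\<omega>. ennreal (Z \<omega>) \<partial>M) < \<infinity>" .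
  qed (auto simp: Z_def)
  have intR: "integrable M (\<lambda>\<omega>. l * \<eta> \<omega> + p + q * Z \<omega>)"
    using \<eta>(1) intZ by auto
  have intf: "integrable M f"
    using fle by (intro Bochner_Integration.integrable_bound[OF intR] AE_I2)
      (auto simp: f_def intro: order_trans[OF _ abs_ge_self])
  have "AE \<omega> in M. real_cond_exp M G f \<omega> \<le> real_cond_exp M G (\<lambda>\<omega>. l * \<eta> \<omega> + p + q * Z \<omega>) \<omega>"
    using fle by (intro real_cond_exp_mono intf intR) auto
  moreover have "AE \<omega> in M. real_cond_exp M G (\<lambda>\<omega>. (l * \<eta> \<omega> + p) + q * Z \<omega>) \<omega>
      = real_cond_exp M G (\<lambda>\<omega>. l * \<eta> \<omega> + p) \<omega> + real_cond_exp M G (\<lambda>\<omega>. q * Z \<omega>) \<omega>"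
    using \<eta>(1) intZ by (intro real_cond_exp_add) auto
  moreover have "AE \<omega> in M. real_cond_exp M G (\<lambda>\<omega>. l * \<eta> \<omega> + p) \<omega>
      = real_cond_exp M G (\<lambda>\<omega>. l * \<eta> \<omega>) \<omega> + real_cond_exp M G (\<lambda>\<omega>. p) \<omega>"
    using \<eta>(1) by (intro real_cond_exp_add) auto
  moreover have "AE \<omega> in M. real_cond_exp M G (\<lambda>\<omega>. l * \<eta> \<omega>) \<omega> = l * real_cond_exp M G \<eta> \<omega>"
    by (rule real_cond_exp_cmult[OF \<eta>(1)])
  moreover have "AE \<omega> in M. real_cond_exp M G (\<lambda>\<omega>. q * Z \<omega>) \<omega> = q * real_cond_exp M G Z \<omega>"
    by (rule real_cond_exp_cmult[OF intZ])
  moreover have "AE \<omega> in M. real_cond_exp M G (\<lambda>\<omega>. p) \<omega> = p"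
    by (intro real_cond_exp_F_meas) auto
  moreover have "AE \<omega> in M. real_cond_exp M G Z \<omega> \<le> exp 1"
    using expZ
  proof eventually_elim
    case (elim \<omega>)
    then have "enn2real (nn_cond_exp M G (\<lambda>\<omega>. ennreal (Z \<omega>)) \<omega>) \<le> exp 1"
      by (intro enn2real_leI) auto
    moreover have "0 \<le> enn2real (nn_cond_exp M G (\<lambda>\<omega>. ennreal (- Z \<omega>)) \<omega>)" by simp
    ultimately show ?case unfolding real_cond_exp_def by linarith
  qed
  moreover note \<eta>(2)
  ultimately have le: "AE \<omega> in M. real_cond_exp M G f \<omega> \<le> exp c"
  proof eventually_elim
    case (elim \<omega>)
    then have "real_cond_exp M G f \<omega> \<le> p + q * real_cond_exp M G Z \<omega>" by simp
    also have "\<dots> \<le> p + q * exp 1" using elim pq by (intro add_left_mono mult_left_mono) auto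
    finally show ?case using pq(3) by simp
  qed
  have neg: "(\<lambda>\<omega>. ennreal (- f \<omega>)) = (\<lambda>_. 0)" by (auto simp: f_def ennreal_neg)
  have "AE \<omega> in M. (0::ennreal) = nn_cond_exp M G (\<lambda>_. 0) \<omega>"
    by (rule nn_cond_exp_F_meas) auto
  moreover have "AE \<omega> in M. nn_cond_exp M G (\<lambda>\<omega>. ennreal (f \<omega>)) \<omega> \<noteq> \<infinity>"
  proof (rule nn_integral_PInf_AE)
    have "(\<integral>\<^sup>+\<omega>. nn_cond_exp M G (\<lambda>\<omega>. ennreal (f \<omega>)) \<omega> \<partial>M) = (\<integral>\<^sup>+\<omega>. ennreal (f \<omega>) \<partial>M)"
      using nn_cond_exp_intg[of "\<lambda>_. 1" "\<lambda>\<omega>. ennreal (f \<omega>)"] by simp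
    also have "\<dots> = ennreal (\<integral>\<omega>. f \<omega> \<partial>M)"
      by (rule nn_integral_eq_integral[OF intf]) (simp add: f_def)
    also have "\<dots> < \<infinity>" by simp
    finally show "(\<integral>\<^sup>+\<omega>. nn_cond_exp M G (\<lambda>\<omega>. ennreal (f \<omega>)) \<omega> \<partial>M) \<noteq> \<infinity>" by simp
  qed measurable
  ultimately have "AE \<omega> in M. nn_cond_exp M G (\<lambda>\<omega>. ennreal (f \<omega>)) \<omega> \<le> ennreal (exp c)"
    using le
  proof eventually_elim
    case (elim \<omega>)
    then have "enn2real (nn_cond_exp M G (\<lambda>\<omega>. ennreal (f \<omega>)) \<omega>) \<le> exp c"
      by (simp add: real_cond_exp_def neg)
    then have "ennreal (enn2real (nn_cond_exp M G (\<lambda>\<omega>. ennreal (f \<omega>)) \<omega>)) \<le> ennreal (exp c)"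
      by (rule ennreal_leI)
    then show ?case using elim by (simp add: less_top)
  qed
  then show ?thesis by (simp add: f_def)
qed

section \<open>The norms of the scale sequence and the threshold\<close>

lemma lq_norm_powr:
  assumes "q > 0" "\<forall>i\<ge>1. \<sigma> i > 0"
  shows "lq_norm q \<sigma> N powr q = (\<Sum>i=1..N. \<sigma> i powr q)"
proof -
  have "(\<Sum>i=1..N. \<bar>\<sigma> i\<bar> powr q) = (\<Sum>i=1..N. \<sigma> i powr q)"
    using assms(2) by (intro sum.cong) (auto simp: abs_of_pos)
  moreover have "0 \<le> (\<Sum>i=1..N. \<sigma> i powr q)" by (intro sum_nonneg) auto
  ultimately show ?thesis using assms(1) by (simp add: lq_norm_def powr_powr)
qed

lemma lq_norm_2: "lq_norm 2 \<sigma> N = sqrt (\<Sum>i=1..N. (\<sigma> i)\<^sup>2)"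
  by (simp add: lq_norm_def powr_half_sqrt sum_nonneg)

lemma lq_norm_pos:
  assumes "N \<ge> 1" "\<forall>i\<ge>1. \<sigma> i > 0"
  shows "lq_norm q \<sigma> N > 0"
proof -
  have "\<bar>\<sigma> i\<bar> powr q > 0" if "i \<in> {1..N}" for i using assms(2) that by auto
  then have "(\<Sum>i=1..N. \<bar>\<sigma> i\<bar> powr q) > 0" using assms(1) by (intro sum_pos) auto
  then show ?thesis by (simp add: lq_norm_def)
qed

lemma linf_norm_ge: "1 \<le> i \<Longrightarrow> i \<le> N \<Longrightarrow> \<bar>\<sigma> i\<bar> \<le> linf_norm \<sigma> N"
  unfolding linf_norm_def by (intro Max_ge) auto

lemma linf_norm_attained:
  assumes "N \<ge> 1"
  obtains j where "1 \<le> j" "j \<le> N" "linf_norm \<sigma> N = \<bar>\<sigma> j\<bar>"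
proof -
  have "linf_norm \<sigma> N \<in> (\<lambda>i. \<bar>\<sigma> i\<bar>) ` {1..N}"
    unfolding linf_norm_def using assms by (intro Max_in) auto
  then show ?thesis using that by auto
qed

lemma linf_norm_le_lq_norm:
  assumes "N \<ge> 1" "q > 0"
  shows "linf_norm \<sigma> N \<le> lq_norm q \<sigma> N"
proof -
  obtain j where j: "1 \<le> j" "j \<le> N" "linf_norm \<sigma> N = \<bar>\<sigma> j\<bar>"
    using linf_norm_attained[OF assms(1)] by blast
  have "\<bar>\<sigma> j\<bar> powr q \<le> (\<Sum>i=1..N. \<bar>\<sigma> i\<bar> powr q)"
    using j by (intro member_le_sum) auto
  then have "(\<bar>\<sigma> j\<bar> powr q) powr (1 / q) \<le> lq_norm q \<sigma> N"
    unfolding lq_norm_def using assms(2) by (intro powr_mono2) auto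
  then show ?thesis using j(3) assms(2) by (simp add: powr_powr)
qed

lemma lq_norm_le_linf_norm:
  assumes "N \<ge> 1" "q > 0"
  shows "lq_norm q \<sigma> N \<le> real N powr (1 / q) * linf_norm \<sigma> N"
proof -
  obtain j where "linf_norm \<sigma> N = \<bar>\<sigma> j\<bar>" using linf_norm_attained[OF assms(1)] by blast
  then have L: "linf_norm \<sigma> N \<ge> 0" by simp
  have "(\<Sum>i=1..N. \<bar>\<sigma> i\<bar> powr q) \<le> (\<Sum>i=1..N. linf_norm \<sigma> N powr q)"
    using assms by (intro sum_mono powr_mono2 linf_norm_ge) auto
  then have "(\<Sum>i=1..N. \<bar>\<sigma> i\<bar> powr q) \<le> real N * linf_norm \<sigma> N powr q" by simp
  then have "lq_norm q \<sigma> N \<le> (real N * linf_norm \<sigma> N powr q) powr (1 / q)"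
    unfolding lq_norm_def using assms by (intro powr_mono2 sum_nonneg) auto
  then show ?thesis using assms L by (simp add: powr_mult powr_powr)
qed

text \<open>Every \<open>\<sigma> i\<close> is at most the 2-norm \<open>L\<close>, so \<open>\<sigma> i powr q \<le> L powr (q - 2) * \<sigma> i powr 2\<close>.\<close>

lemma lq_norm_antimono:
  assumes "N \<ge> 1" "\<forall>i\<ge>1. \<sigma> i > 0" "2 \<le> q"
  shows "lq_norm q \<sigma> N \<le> lq_norm 2 \<sigma> N"
proof -
  define L where "L = lq_norm 2 \<sigma> N"
  have L: "L > 0" unfolding L_def by (rule lq_norm_pos[OF assms(1,2)])
  have L2: "(\<Sum>i=1..N. \<sigma> i powr 2) = L powr 2"
    using lq_norm_powr[of 2 \<sigma> N] assms by (simp add: L_def)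
  have "\<sigma> i powr q \<le> L powr (q - 2) * \<sigma> i powr 2" if i: "i \<in> {1..N}" for i
  proof -
    have s: "\<sigma> i > 0" using assms(2) i by auto
    have "\<sigma> i \<le> linf_norm \<sigma> N" using linf_norm_ge[of i N \<sigma>] i s by simp
    also have "\<dots> \<le> L" unfolding L_def using assms(1) by (intro linf_norm_le_lq_norm) auto
    finally have "\<sigma> i powr (q - 2) * \<sigma> i powr 2 \<le> L powr (q - 2) * \<sigma> i powr 2"
      using s assms(3) by (intro mult_right_mono powr_mono2) auto
    then show ?thesis by (simp flip: powr_add)
  qed
  then have "lq_norm q \<sigma> N powr q \<le> (\<Sum>i=1..N. L powr (q - 2) * \<sigma> i powr 2)"
    using assms by (subst lq_norm_powr) (auto intro!: sum_mono)
  also have "\<dots> = L powr (q - 2) * L powr 2" unfolding L2[symmetric] by (rule sum_distrib_left[symmetric])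
  also have "\<dots> = L powr q" by (simp flip: powr_add)
  finally have "(lq_norm q \<sigma> N powr q) powr (1 / q) \<le> (L powr q) powr (1 / q)"
    using assms(3) by - (rule powr_mono2, auto)
  moreover have "lq_norm q \<sigma> N > 0" by (rule lq_norm_pos[OF assms(1,2)])
  ultimately show ?thesis using assms(3) L by (simp add: powr_powr flip: L_def)
qed

text \<open>Both norms agree up to the factor \<open>N powr (1 / q)\<close>, which tends to one.\<close>

lemma lq_norm_tendsto_linf_norm:
  assumes "N \<ge> 1"
  shows "((\<lambda>q. lq_norm q \<sigma> N) \<longlongrightarrow> linf_norm \<sigma> N) at_top"
proof (rule tendsto_sandwich)
  show "\<forall>\<^sub>F q in at_top. linf_norm \<sigma> N \<le> lq_norm q \<sigma> N"
    using eventually_gt_at_top[of 0] by eventually_elim (rule linf_norm_le_lq_norm[OF assms])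
  show "\<forall>\<^sub>F q in at_top. lq_norm q \<sigma> N \<le> real N powr (1 / q) * linf_norm \<sigma> N"
    using eventually_gt_at_top[of 0] by eventually_elim (rule lq_norm_le_linf_norm[OF assms])
  have "((\<lambda>q::real. 1 / q) \<longlongrightarrow> 0) at_top" by real_asymp
  then have "((\<lambda>q. real N powr (1 / q) * linf_norm \<sigma> N) \<longlongrightarrow> real N powr 0 * linf_norm \<sigma> N) at_top"
    using assms by (intro tendsto_intros) auto
  then show "((\<lambda>q. real N powr (1 / q) * linf_norm \<sigma> N) \<longlongrightarrow> linf_norm \<sigma> N) at_top"
    using assms by simp
qed simp

lemma alpha_star_gt_2: "1 < \<alpha> \<Longrightarrow> \<alpha> < 2 \<Longrightarrow> alpha_star \<alpha> > 2"
  by (simp add: alpha_star_def field_simps)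

lemma norm_ratio_ge_1:
  assumes "N \<ge> 1" "\<forall>i\<ge>1. \<sigma> i > 0" "1 < \<alpha>" "\<alpha> < 2"
  shows "1 \<le> (lq_norm 2 \<sigma> N / lq_norm (alpha_star \<alpha>) \<sigma> N) powr (\<alpha> / (2 - \<alpha>))"
proof (rule ge_one_powr_ge_zero)
  show "1 \<le> lq_norm 2 \<sigma> N / lq_norm (alpha_star \<alpha>) \<sigma> N"
    using lq_norm_antimono[OF assms(1,2), of "alpha_star \<alpha>"] alpha_star_gt_2[OF assms(3,4)]
      lq_norm_pos[OF assms(1,2), of "alpha_star \<alpha>"] by simp
qed (use assms in auto)

text \<open>In terms of \<open>q = alpha_star \<alpha>\<close> the exponent of the numerical factor is \<open>1 / (q - 2)\<close>, and
  \<open>8 * q / 2 powr q \<ge> 4 / 2 powr q = 2 powr (2 - q)\<close>, so the factor is at least \<open>1 / 2\<close>.\<close>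

lemma gamma_star_ge:
  assumes "N \<ge> 1" "\<forall>i\<ge>1. \<sigma> i > 0" "1 < \<alpha>" "\<alpha> < 2"
  shows "ereal (16 * (lq_norm 2 \<sigma> N / lq_norm (alpha_star \<alpha>) \<sigma> N) powr (\<alpha> / (2 - \<alpha>))) \<le> gamma_star \<alpha> \<sigma> N"
proof -
  define q where "q = alpha_star \<alpha>"
  have q: "q > 2" unfolding q_def by (rule alpha_star_gt_2[OF assms(3,4)])
  have e: "(\<alpha> - 1) / (2 - \<alpha>) = 1 / (q - 2)"
    using assms(3,4) by (simp add: q_def alpha_star_def field_simps)
  have "2 powr (2 - q) = 4 / 2 powr q" by (simp add: powr_diff)
  also have "\<dots> \<le> 8 * q / 2 powr q" using q by (intro divide_right_mono) auto
  finally have "(2 powr (2 - q)) powr (1 / (q - 2)) \<le> (8 * q / 2 powr q) powr (1 / (q - 2))"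
    using q by (intro powr_mono2) auto
  moreover have "(2 powr (2 - q)) powr (1 / (q - 2)) = (1 / 2 :: real)"
  proof -
    have "(2 - q) * (1 / (q - 2)) = - 1" using q by (simp add: field_simps)
    then have "(2 powr (2 - q)) powr (1 / (q - 2)) = (2 :: real) powr (- 1)" by (simp only: powr_powr)
    then show ?thesis by (simp add: powr_minus_divide)
  qed
  ultimately have "16 \<le> 32 * (8 * q / 2 powr q) powr ((\<alpha> - 1) / (2 - \<alpha>))" unfolding e by simp
  then have "16 * (lq_norm 2 \<sigma> N / lq_norm q \<sigma> N) powr (\<alpha> / (2 - \<alpha>))
    \<le> 32 * (8 * q / 2 powr q) powr ((\<alpha> - 1) / (2 - \<alpha>)) * (lq_norm 2 \<sigma> N / lq_norm q \<sigma> N) powr (\<alpha> / (2 - \<alpha>))"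
    by (intro mult_right_mono) auto
  then show ?thesis using assms(3,4) by (simp add: gamma_star_def q_def)
qed

lemma gamma_star_tendsto_at_right_1:
  assumes "N \<ge> 1" "\<forall>i\<ge>1. \<sigma> i > 0"
  shows "((\<lambda>\<alpha>. gamma_star \<alpha> \<sigma> N) \<longlongrightarrow> gamma_star 1 \<sigma> N) (at_right 1)"
proof -
  define R where "R \<alpha> = lq_norm 2 \<sigma> N / lq_norm (alpha_star \<alpha>) \<sigma> N" for \<alpha>
  obtain j where "1 \<le> j" "linf_norm \<sigma> N = \<bar>\<sigma> j\<bar>" using linf_norm_attained[OF assms(1)] by blast
  then have Lpos: "linf_norm \<sigma> N > 0" using assms(2) by auto
  have "filterlim alpha_star at_top (at_right 1)"
    unfolding alpha_star_def by real_asymp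
  then have "((\<lambda>\<alpha>. lq_norm (alpha_star \<alpha>) \<sigma> N) \<longlongrightarrow> linf_norm \<sigma> N) (at_right 1)"
    by (rule filterlim_compose[OF lq_norm_tendsto_linf_norm[OF assms(1)]])
  then have R: "(R \<longlongrightarrow> lq_norm 2 \<sigma> N / linf_norm \<sigma> N) (at_right 1)"
    unfolding R_def using Lpos by (intro tendsto_intros) auto
  have "((\<lambda>\<alpha>::real. \<alpha> / (2 - \<alpha>)) \<longlongrightarrow> 1) (at_right 1)" by real_asymp
  then have "((\<lambda>\<alpha>. R \<alpha> powr (\<alpha> / (2 - \<alpha>))) \<longlongrightarrow> (lq_norm 2 \<sigma> N / linf_norm \<sigma> N) powr 1) (at_right 1)"
    using R Lpos lq_norm_pos[OF assms, of 2] by (intro tendsto_powr) auto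
  moreover have "((\<lambda>\<alpha>::real. 32 * (8 * alpha_star \<alpha> / 2 powr alpha_star \<alpha>) powr ((\<alpha> - 1) / (2 - \<alpha>)))
      \<longlongrightarrow> 32 * exp (- ln 2)) (at_right 1)"
    unfolding alpha_star_def by real_asymp
  ultimately have "((\<lambda>\<alpha>. 32 * (8 * alpha_star \<alpha> / 2 powr alpha_star \<alpha>) powr ((\<alpha> - 1) / (2 - \<alpha>))
      * R \<alpha> powr (\<alpha> / (2 - \<alpha>))) \<longlongrightarrow> 32 * exp (- ln 2) * (lq_norm 2 \<sigma> N / linf_norm \<sigma> N) powr 1) (at_right 1)"
    by (rule tendsto_mult[rotated])
  then have "((\<lambda>\<alpha>. ereal (32 * (8 * alpha_star \<alpha> / 2 powr alpha_star \<alpha>) powr ((\<alpha> - 1) / (2 - \<alpha>))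
      * R \<alpha> powr (\<alpha> / (2 - \<alpha>)))) \<longlongrightarrow> gamma_star 1 \<sigma> N) (at_right 1)"
    using Lpos lq_norm_pos[OF assms, of 2] by (simp add: gamma_star_def exp_minus)
  moreover have "\<forall>\<^sub>F \<alpha> in at_right 1. ereal (32 * (8 * alpha_star \<alpha> / 2 powr alpha_star \<alpha>) powr ((\<alpha> - 1) / (2 - \<alpha>))
      * R \<alpha> powr (\<alpha> / (2 - \<alpha>))) = gamma_star \<alpha> \<sigma> N"
    using eventually_at_right_less[of 1] eventually_at_right_field[of "\<lambda>a. a < 2" "1::real"]
    by (auto simp: gamma_star_def R_def eventually_at_right_field intro!: exI[of _ 2])
  ultimately show ?thesis by (rule Lim_transform_eventually)
qed

text \<open>The base of the numerical factor tends to 4 while its exponent tends to infinity, and the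
  ratio of the norms stays at least one.\<close>

lemma gamma_star_tendsto_at_left_2:
  assumes "N \<ge> 1" "\<forall>i\<ge>1. \<sigma> i > 0"
  shows "((\<lambda>\<alpha>. gamma_star \<alpha> \<sigma> N) \<longlongrightarrow> gamma_star 2 \<sigma> N) (at_left 2)"
proof -
  have "((\<lambda>\<alpha>::real. 8 * (\<alpha> / (\<alpha> - 1)) / 2 powr (\<alpha> / (\<alpha> - 1))) \<longlongrightarrow> 4) (at_left 2)"
  proof -
    have "((\<lambda>\<alpha>::real. 8 * (\<alpha> / (\<alpha> - 1)) / 2 powr (\<alpha> / (\<alpha> - 1))) \<longlongrightarrow> 8 * (2 / (2 - 1)) / 2 powr (2 / (2 - 1))) (at_left 2)"
      by (intro tendsto_intros) auto
    then show ?thesis by simp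
  qed
  then have base: "\<forall>\<^sub>F \<alpha> in at_left 2. 2 < 8 * alpha_star \<alpha> / 2 powr alpha_star \<alpha>"
    unfolding alpha_star_def by (rule order_tendstoD) simp
  have range: "\<forall>\<^sub>F \<alpha> in at_left (2::real). 1 < \<alpha> \<and> \<alpha> < 2"
    unfolding eventually_at_left_field by (intro exI[of _ 1]) auto
  have "\<forall>\<^sub>F \<alpha> in at_left 2. ereal (2 powr ((\<alpha> - 1) / (2 - \<alpha>))) \<le> gamma_star \<alpha> \<sigma> N"
    using base range
  proof eventually_elim
    case (elim \<alpha>)
    define A where "A = (8 * alpha_star \<alpha> / 2 powr alpha_star \<alpha>) powr ((\<alpha> - 1) / (2 - \<alpha>))"
    define B where "B = (lq_norm 2 \<sigma> N / lq_norm (alpha_star \<alpha>) \<sigma> N) powr (\<alpha> / (2 - \<alpha>))"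
    have "2 powr ((\<alpha> - 1) / (2 - \<alpha>)) \<le> A"
      unfolding A_def using elim by (intro powr_mono2) auto
    moreover have "1 \<le> B"
      unfolding B_def using elim by (intro norm_ratio_ge_1[OF assms]) auto
    moreover have "0 < 2 powr ((\<alpha> - 1) / (2 - \<alpha>))" by simp
    ultimately have "2 powr ((\<alpha> - 1) / (2 - \<alpha>)) * 1 \<le> (32 * A) * B"
      by (intro mult_mono) linarith+
    then show ?case using elim by (simp add: gamma_star_def A_def B_def)
  qed
  moreover have "filterlim (\<lambda>\<alpha>::real. 2 powr ((\<alpha> - 1) / (2 - \<alpha>))) at_top (at_left 2)"
    by real_asymp
  then have "\<forall>\<^sub>F \<alpha> in at_left (2::real). r < 2 powr ((\<alpha> - 1) / (2 - \<alpha>))" for r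
    unfolding filterlim_at_top_dense by blast
  ultimately have "\<forall>\<^sub>F \<alpha> in at_left 2. ereal r < gamma_star \<alpha> \<sigma> N" for r
  proof (rule eventually_elim2)
    show "ereal r < gamma_star \<alpha> \<sigma> N"
      if "ereal (2 powr ((\<alpha> - 1) / (2 - \<alpha>))) \<le> gamma_star \<alpha> \<sigma> N" "r < 2 powr ((\<alpha> - 1) / (2 - \<alpha>))" for \<alpha>
      using that by (metis less_ereal.simps(1) less_le_trans)
  qed
  then have "((\<lambda>\<alpha>. gamma_star \<alpha> \<sigma> N) \<longlongrightarrow> \<infinity>) (at_left 2)"
    unfolding tendsto_PInfty by blast
  then show ?thesis by (simp add: gamma_star_def)
qed

text \<open>In this normal form the numerical powers collapse: for every \<open>\<alpha>\<close> one has
  \<open>32 powr (2 - \<alpha>) * 64 powr (\<alpha> - 1) / 2 powr \<alpha> = 16\<close>.  The remaining factor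
  \<open>(q / 8) powr (\<alpha> - 1)\<close> is the one produced by the optimal parameter of the Chernoff bound.\<close>

lemma gamma_star_powr:
  assumes "1 < \<alpha>" "\<alpha> < 2" "N \<ge> 1" "\<forall>i\<ge>1. \<sigma> i > 0"
  defines "q \<equiv> alpha_star \<alpha>" and "R \<equiv> lq_norm 2 \<sigma> N / lq_norm (alpha_star \<alpha>) \<sigma> N"
  shows "real_of_ereal (gamma_star \<alpha> \<sigma> N) powr (2 - \<alpha>) = 16 * (q / 8) powr (\<alpha> - 1) * R powr \<alpha>"
proof -
  have q: "q > 2" unfolding q_def by (rule alpha_star_gt_2[OF assms(1,2)])
  have R: "R > 0" unfolding R_def using lq_norm_pos[OF assms(3,4)] by simp
  have qa: "q * (\<alpha> - 1) = \<alpha>" using assms(1) by (simp add: q_def alpha_star_def)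
  have R_q: "lq_norm 2 \<sigma> N / lq_norm q \<sigma> N = R" by (simp add: R_def q_def)
  have "real_of_ereal (gamma_star \<alpha> \<sigma> N) powr (2 - \<alpha>)
    = 32 powr (2 - \<alpha>) * (8 * q / 2 powr q) powr (\<alpha> - 1) * R powr \<alpha>"
    using assms(1,2) q R by (simp add: gamma_star_def q_def[symmetric] R_q powr_mult powr_powr)
  also have "(8 * q / 2 powr q) powr (\<alpha> - 1) = (64 * (q / 8)) powr (\<alpha> - 1) / 2 powr \<alpha>"
    using q by (simp add: powr_divide powr_powr qa)
  also have "(64 * (q / 8)) powr (\<alpha> - 1) = 64 powr (\<alpha> - 1) * (q / 8) powr (\<alpha> - 1)"
    using q by (intro powr_mult) 
  also have "32 powr (2 - \<alpha>) * (64 powr (\<alpha> - 1) * (q / 8) powr (\<alpha> - 1) / 2 powr \<alpha>)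
    = (32 powr (2 - \<alpha>) * 64 powr (\<alpha> - 1) / 2 powr \<alpha>) * (q / 8) powr (\<alpha> - 1)" by simp
  also have "32 powr (2 - \<alpha>) * 64 powr (\<alpha> - 1) / 2 powr \<alpha> = (16 :: real)"
  proof -
    have "(32 :: real) = 2 powr 5" "(64 :: real) = 2 powr 6" by (simp_all add: powr_numeral)
    then have "32 powr (2 - \<alpha>) * 64 powr (\<alpha> - 1) / 2 powr \<alpha>
        = (2::real) powr (5 * (2 - \<alpha>)) * 2 powr (6 * (\<alpha> - 1)) / 2 powr \<alpha>"
      by (simp only: powr_powr)
    also have "\<dots> = 2 powr (5 * (2 - \<alpha>) + 6 * (\<alpha> - 1) - \<alpha>)" by (simp only: powr_add powr_diff)
    also have "5 * (2 - \<alpha>) + 6 * (\<alpha> - 1) - \<alpha> = 4" by simp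
    finally show ?thesis by (simp add: powr_numeral)
  qed
  finally show ?thesis .
qed

section \<open>Tail bounds for martingale-differences\<close>

locale regular_martingale_difference =
  fixes M :: "'w measure" and F :: "nat \<Rightarrow> 'w measure"
    and \<xi> :: "nat \<Rightarrow> 'w \<Rightarrow> 'e::{banach, second_countable_topology}"
    and \<sigma> :: "nat \<Rightarrow> real" and \<kappa> :: real
  assumes prob: "prob_space M" and M_subalg: "\<And>i. subalgebra M (F i)"
    and filt: "filtration (space M) F"
    and fin_dim: "\<exists>B :: 'e set. finite B \<and> span B = UNIV"
    and reg: "kappa_regular \<kappa> (norm :: 'e \<Rightarrow> real)" and \<kappa>: "\<kappa> > 0"
    and sigma: "\<And>i. i \<ge> 1 \<Longrightarrow> \<sigma> i > 0"
    and mart: "martingale_difference M F \<xi>"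
begin

text \<open>The conditional moment bounds multiply to
  \<open>E (exp (\<tau> * V S\<^sub>N)) \<le> exp (\<Sum>i. c i)\<close>, since \<open>exp (\<tau> * V S\<^sub>i)\<close> is known at time \<open>i\<close>; Markov's
  inequality and \<open>norm x \<le> V x + \<beta> / 2\<close> finish the proof.  Nonnegative integrals avoid any question of
  integrability of the products.\<close>

lemma chernoff_bound:
  assumes C: "cond_C M F \<sigma> \<xi> \<alpha>"
    and \<beta>: "\<beta> > 0" and \<tau>: "\<tau> \<ge> 0"
    and maj: "\<And>i. 1 \<le> i \<Longrightarrow> i \<le> N \<Longrightarrow> affine_majorant \<alpha> (\<kappa> / (2 * \<beta>)) \<tau> (\<sigma> i) (c i)"
  shows "\<P>(\<omega> in M. norm (\<Sum>i=1..N. \<xi> i \<omega>) \<ge> r) \<le> exp ((\<Sum>i=1..N. c i) - \<tau> * (r - \<beta> / 2))"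
proof -
  interpret prob_space M by (rule prob)
  obtain B0 :: "'e set" where fin: "finite B0" "span B0 = UNIV" using fin_dim by blast
  obtain V :: "'e \<Rightarrow> real" and g :: "'e \<Rightarrow> 'e \<Rightarrow> real" where V0: "V 0 = 0"
    and lower: "\<And>x. norm x \<le> V x + \<beta> / 2"
    and lip: "\<And>x y. \<bar>V (x + y) - V x\<bar> \<le> norm y"
    and upper: "\<And>x y. V (x + y) \<le> V x + g x y + \<kappa> / (2 * \<beta>) * (norm y)\<^sup>2"
    and g: "\<And>x. linear (g x)" "\<And>x y. \<bar>g x y\<bar> \<le> norm y"
      "\<And>y. (\<lambda>x. g x y) \<in> borel_measurable borel"
    using smooth_minorant_of_regular_norm[OF fin reg \<beta>] by blast
  have "continuous_on UNIV V"
  proof (rule lipschitz_on_continuous_on[where L = 1], rule lipschitz_onI)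
    show "dist (V x) (V y) \<le> 1 * dist x y" for x y
      using lip[of y "x - y"] by (simp add: dist_norm)
  qed auto
  then have Vm: "V \<in> borel_measurable borel" by (rule borel_measurable_continuous_onI)
  define S where "S n \<omega> = (\<Sum>i=1..n. \<xi> i \<omega>)" for n \<omega>
  have \<xi>F: "\<xi> i \<in> borel_measurable (F i)" if "i \<ge> 1" for i
    using mart that unfolding martingale_difference_def by blast
  have \<xi>M: "\<xi> i \<in> borel_measurable M" if "i \<ge> 1" for i
    by (rule measurable_from_subalg[OF M_subalg \<xi>F[OF that]])
  have up_F: "f \<in> borel_measurable (F n)" if "f \<in> borel_measurable (F i)" "i \<le> n"
    for f :: "'w \<Rightarrow> 'e" and i n
  proof (rule measurable_from_subalg[OF _ that(1)])
    show "subalgebra (F n) (F i)"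
      using filtration.sets_F_mono[OF filt that(2)] filtration.space_F[OF filt]
      by (simp add: subalgebra_def)
  qed
  have SF: "S n \<in> borel_measurable (F n)" for n
    unfolding S_def by (intro borel_measurable_sum up_F[OF \<xi>F]) auto
  have SM: "S n \<in> borel_measurable M" for n
    by (rule measurable_from_subalg[OF M_subalg SF])
  define W where "W n \<omega> = ennreal (exp (\<tau> * V (S n \<omega>)))" for n \<omega>
  have WF: "W n \<in> borel_measurable (F n)" for n
    unfolding W_def using measurable_compose[OF SF Vm] by measurable
  have step: "(\<integral>\<^sup>+\<omega>. W (Suc n) \<omega> \<partial>M) \<le> ennreal (exp (c (Suc n))) * (\<integral>\<^sup>+\<omega>. W n \<omega> \<partial>M)"
    if n: "Suc n \<le> N" for n
  proof -
    interpret finite_measure_subalgebra M "F n" using M_subalg by unfold_locales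
    define s where "s = \<sigma> (Suc n)"
    have s: "s > 0" using sigma by (simp add: s_def)
    define D X where "D \<omega> = V (S (Suc n) \<omega>) - V (S n \<omega>)" and "X \<omega> = norm (\<xi> (Suc n) \<omega>) / s" for \<omega>
    have sX: "s * X \<omega> = norm (\<xi> (Suc n) \<omega>)" for \<omega> using s by (simp add: X_def)
    have S_Suc: "S (Suc n) \<omega> = S n \<omega> + \<xi> (Suc n) \<omega>" for \<omega> by (simp add: S_def)
    have ce: "has_cond_exp M (F n) (\<xi> (Suc n)) (\<lambda>_. 0)"
      using mart unfolding martingale_difference_def by (metis diff_Suc_1 le_add1 plus_1_eq_Suc)
    have Z: "exp (norm (\<xi> (Suc n) \<omega>) powr \<alpha> * \<sigma> (Suc n) powr (- \<alpha>)) = exp (X \<omega> powr \<alpha>)" for \<omega>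
      using s by (simp add: X_def s_def powr_divide powr_minus_divide)
    have Dm: "D \<in> borel_measurable M"
      unfolding D_def using measurable_compose[OF SM Vm] by measurable
    have "AE \<omega> in M. nn_cond_exp M (F n) (\<lambda>\<omega>. ennreal (exp (\<tau> * D \<omega>))) \<omega> \<le> ennreal (exp (c (Suc n)))"
    proof (rule nn_cond_exp_le_of_affine_majorant[OF prob M_subalg])
      show "affine_majorant \<alpha> (\<kappa> / (2 * \<beta>)) \<tau> s (c (Suc n))" using maj n by (simp add: s_def)
      show "X \<in> borel_measurable M" unfolding X_def using \<xi>M[of "Suc n"] by measurable
      show "AE \<omega> in M. nn_cond_exp M (F n) (\<lambda>\<omega>. ennreal (exp (X \<omega> powr \<alpha>))) \<omega> \<le> ennreal (exp 1)"
        using C[unfolded cond_C_def, rule_format, of "Suc n"] by (simp add: Z)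
      show "integrable M (\<lambda>\<omega>. g (S n \<omega>) (\<xi> (Suc n) \<omega>))"
        and "AE \<omega> in M. real_cond_exp M (F n) (\<lambda>\<omega>. g (S n \<omega>) (\<xi> (Suc n) \<omega>)) \<omega> = 0"
        by (fact cond_exp_linear_functional_zero[OF prob M_subalg fin ce SF g])+
      show "0 \<le> X \<omega>" for \<omega> using s by (simp add: X_def)
      show "\<bar>D \<omega>\<bar> \<le> s * X \<omega>" for \<omega> unfolding sX D_def S_Suc by (rule lip)
      show "D \<omega> \<le> g (S n \<omega>) (\<xi> (Suc n) \<omega>) + \<kappa> / (2 * \<beta>) * (s * X \<omega>)\<^sup>2" for \<omega>
        unfolding sX D_def S_Suc using upper[of "S n \<omega>" "\<xi> (Suc n) \<omega>"] by simp
    qed (fact Dm)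
    then have "(\<integral>\<^sup>+\<omega>. W n \<omega> * nn_cond_exp M (F n) (\<lambda>\<omega>. ennreal (exp (\<tau> * D \<omega>))) \<omega> \<partial>M)
        \<le> (\<integral>\<^sup>+\<omega>. W n \<omega> * ennreal (exp (c (Suc n))) \<partial>M)"
      by (intro nn_integral_mono_AE) (auto intro: mult_left_mono elim!: eventually_mono)
    also have "\<dots> = ennreal (exp (c (Suc n))) * (\<integral>\<^sup>+\<omega>. W n \<omega> \<partial>M)"
      using measurable_from_subalg[OF M_subalg WF] by (simp add: nn_integral_multc mult.commute)
    also have "(\<integral>\<^sup>+\<omega>. W n \<omega> * nn_cond_exp M (F n) (\<lambda>\<omega>. ennreal (exp (\<tau> * D \<omega>))) \<omega> \<partial>M)
        = (\<integral>\<^sup>+\<omega>. W n \<omega> * ennreal (exp (\<tau> * D \<omega>)) \<partial>M)"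
      using Dm by (intro nn_cond_exp_intg WF) measurable
    also have "\<dots> = (\<integral>\<^sup>+\<omega>. W (Suc n) \<omega> \<partial>M)"
      by (simp add: W_def D_def algebra_simps flip: ennreal_mult exp_add)
    finally show ?thesis .
  qed
  have W: "n \<le> N \<Longrightarrow> (\<integral>\<^sup>+\<omega>. W n \<omega> \<partial>M) \<le> ennreal (exp (\<Sum>i=1..n. c i))" for n
  proof (induction n)
    case 0
    then show ?case by (simp add: W_def S_def V0 emeasure_space_1)
  next
    case (Suc n)
    have "(\<integral>\<^sup>+\<omega>. W (Suc n) \<omega> \<partial>M) \<le> ennreal (exp (c (Suc n))) * ennreal (exp (\<Sum>i=1..n. c i))"
      using step[OF Suc.prems] Suc by (meson Suc_leD mult_left_mono order_trans zero_le)
    also have "\<dots> = ennreal (exp (\<Sum>i=1..Suc n. c i))"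
      by (simp add: add.commute flip: ennreal_mult exp_add)
    finally show ?case .
  qed
  define A where "A = {\<omega> \<in> space M. r \<le> norm (S N \<omega>)}"
  have AM: "A \<in> sets M" unfolding A_def using SM[of N] by measurable
  define K where "K = exp (- \<tau> * (r - \<beta> / 2))"
  have "emeasure M A = (\<integral>\<^sup>+\<omega>. indicator A \<omega> \<partial>M)" using AM by simp
  also have "\<dots> \<le> (\<integral>\<^sup>+\<omega>. ennreal K * W N \<omega> \<partial>M)"
  proof (rule nn_integral_mono)
    fix \<omega>
    have "1 \<le> K * exp (\<tau> * V (S N \<omega>))" if "r \<le> norm (S N \<omega>)"
    proof -
      have "\<tau> * (r - \<beta> / 2) \<le> \<tau> * V (S N \<omega>)"
        using that lower[of "S N \<omega>"] \<tau> by (intro mult_left_mono) auto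
      then show ?thesis by (simp add: K_def flip: exp_add)
    qed
    then have "ennreal 1 \<le> ennreal (K * exp (\<tau> * V (S N \<omega>)))" if "r \<le> norm (S N \<omega>)"
      using that by (intro ennreal_leI)
    then show "indicator A \<omega> \<le> ennreal K * W N \<omega>"
      by (auto simp: A_def W_def K_def ennreal_mult split: split_indicator)
  qed
  also have "\<dots> = ennreal K * (\<integral>\<^sup>+\<omega>. W N \<omega> \<partial>M)"
    using measurable_from_subalg[OF M_subalg WF] by (rule nn_integral_cmult)
  also have "\<dots> \<le> ennreal K * ennreal (exp (\<Sum>i=1..N. c i))"
    using W[of N] by (intro mult_left_mono) auto
  also have "\<dots> = ennreal (exp ((\<Sum>i=1..N. c i) - \<tau> * (r - \<beta> / 2)))"
    by (simp add: K_def add.commute flip: ennreal_mult exp_add)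
  finally have "measure M A \<le> exp ((\<Sum>i=1..N. c i) - \<tau> * (r - \<beta> / 2))"
    by (simp add: emeasure_eq_measure)
  then show ?thesis by (simp add: A_def S_def)
qed

text \<open>With \<open>\<beta> = sqrt (A * \<kappa>) * s\<close> the loss \<open>\<beta> / 2\<close> and the drift
  \<open>A * \<kappa> * s\<^sup>2 / (2 * \<beta>)\<close> are both \<open>sqrt (A * \<kappa>) * s / 2\<close>, so together they stay below the
  deterministic part \<open>sqrt (2 * A * \<kappa>) * s\<close> of the threshold.\<close>

lemma tail_bound_from_majorants:
  assumes C: "cond_C M F \<sigma> \<xi> \<alpha>"
    and N: "N \<ge> 1" and \<tau>: "\<tau> \<ge> 0" and A: "A > 0"
    and maj: "\<And>i m. 1 \<le> i \<Longrightarrow> i \<le> N \<Longrightarrow> 0 \<le> m \<Longrightarrow>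
      affine_majorant \<alpha> m \<tau> (\<sigma> i) (A * \<tau> * m * (\<sigma> i)\<^sup>2 + d i)"
  shows "\<P>(\<omega> in M. norm (\<Sum>i=1..N. \<xi> i \<omega>) \<ge> (sqrt (2 * A * \<kappa>) + \<rho>) * sqrt (\<Sum>i=1..N. (\<sigma> i)\<^sup>2))
    \<le> exp ((\<Sum>i=1..N. d i) - \<tau> * (\<rho> * sqrt (\<Sum>i=1..N. (\<sigma> i)\<^sup>2)))"
proof -
  define s where "s = sqrt (\<Sum>i=1..N. (\<sigma> i)\<^sup>2)"
  have s: "s > 0"
    unfolding s_def lq_norm_2[symmetric] using sigma by (intro lq_norm_pos N) blast
  have s2: "s\<^sup>2 = (\<Sum>i=1..N. (\<sigma> i)\<^sup>2)" by (simp add: s_def sum_nonneg)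
  define k where "k = sqrt (A * \<kappa>)"
  have k: "k > 0" and k2: "k * k = A * \<kappa>" using A \<kappa> by (auto simp: k_def)
  define \<beta> where "\<beta> = k * s"
  have \<beta>: "\<beta> > 0" using k s by (simp add: \<beta>_def)
  define r where "r = (sqrt (2 * A * \<kappa>) + \<rho>) * s"
  define m where "m = \<kappa> / (2 * \<beta>)"
  have m: "m \<ge> 0" using \<kappa> \<beta> by (simp add: m_def)
  have "\<P>(\<omega> in M. norm (\<Sum>i=1..N. \<xi> i \<omega>) \<ge> r)
      \<le> exp ((\<Sum>i=1..N. A * \<tau> * m * (\<sigma> i)\<^sup>2 + d i) - \<tau> * (r - \<beta> / 2))"
  proof (rule chernoff_bound[OF C \<beta> \<tau>])
    show "affine_majorant \<alpha> (\<kappa> / (2 * \<beta>)) \<tau> (\<sigma> i) (A * \<tau> * m * (\<sigma> i)\<^sup>2 + d i)"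
      if "1 \<le> i" "i \<le> N" for i
      using maj[OF that m] by (simp only: m_def)
  qed
  also have "\<dots> \<le> exp ((\<Sum>i=1..N. d i) - \<tau> * (\<rho> * s))"
  proof -
    have "(\<Sum>i=1..N. A * \<tau> * m * (\<sigma> i)\<^sup>2 + d i) = A * \<tau> * m * s\<^sup>2 + (\<Sum>i=1..N. d i)"
      by (simp add: s2 sum.distrib sum_distrib_left)
    moreover have "A * \<tau> * m * s\<^sup>2 = \<tau> * (\<beta> / 2)"
    proof -
      have "A * m * s\<^sup>2 = (k * k) * s\<^sup>2 / (2 * \<beta>)" by (simp add: m_def k2)
      also have "\<dots> = \<beta> * \<beta> / (2 * \<beta>)" by (simp add: \<beta>_def power2_eq_square mult_ac)
      also have "\<dots> = \<beta> / 2" using \<beta> by simp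
      finally show ?thesis by (simp add: mult_ac)
    qed
    moreover have "\<tau> * (\<beta> + \<rho> * s) \<le> \<tau> * r"
    proof (rule mult_left_mono[OF _ \<tau>])
      have "k \<le> sqrt (2 * A * \<kappa>)" using A \<kappa> unfolding k_def by (intro real_sqrt_le_mono) simp
      then have "k * s \<le> sqrt (2 * A * \<kappa>) * s" using s by (intro mult_right_mono) auto
      then show "\<beta> + \<rho> * s \<le> r" by (simp add: r_def \<beta>_def distrib_right)
    qed
    ultimately show ?thesis
      unfolding exp_le_cancel_iff right_diff_distrib distrib_left by linarith
  qed
  finally show ?thesis by (simp add: r_def s_def)
qed

lemma gaussian_tail_bound:
  assumes C: "cond_C M F \<sigma> \<xi> 2"
    and N: "N \<ge> 1" and \<gamma>: "\<gamma> \<ge> 0"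
  shows "\<P>(\<omega> in M. norm (\<Sum>i=1..N. \<xi> i \<omega>) \<ge> (sqrt (2 * \<kappa>) + sqrt 2 * \<gamma>) * sqrt (\<Sum>i=1..N. (\<sigma> i)\<^sup>2))
    \<le> exp (- \<gamma>\<^sup>2 / 2)"
proof -
  define s where "s = sqrt (\<Sum>i=1..N. (\<sigma> i)\<^sup>2)"
  have s: "s > 0"
    unfolding s_def lq_norm_2[symmetric] using sigma by (intro lq_norm_pos N) blast
  have s2: "s\<^sup>2 = (\<Sum>i=1..N. (\<sigma> i)\<^sup>2)" by (simp add: s_def sum_nonneg)
  (* the minimiser of u^2 - sqrt 2 * \<gamma> * u *)
  define u where "u = sqrt 2 * \<gamma> / 2"
  define \<tau> where "\<tau> = u / s"
  have \<tau>: "\<tau> \<ge> 0" using \<gamma> s by (simp add: \<tau>_def u_def)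
  have ts: "\<tau> * s = u" using s by (simp add: \<tau>_def)
  have "\<P>(\<omega> in M. norm (\<Sum>i=1..N. \<xi> i \<omega>) \<ge> (sqrt (2 * 1 * \<kappa>) + sqrt 2 * \<gamma>) * sqrt (\<Sum>i=1..N. (\<sigma> i)\<^sup>2))
    \<le> exp ((\<Sum>i=1..N. (\<tau> * \<sigma> i)\<^sup>2) - \<tau> * (sqrt 2 * \<gamma> * sqrt (\<Sum>i=1..N. (\<sigma> i)\<^sup>2)))"
    using affine_majorant_2[OF \<tau>] sigma
    by (intro tail_bound_from_majorants[OF C N \<tau>]) auto
  also have "(\<Sum>i=1..N. (\<tau> * \<sigma> i)\<^sup>2) = (\<tau> * s)\<^sup>2"
    by (simp add: power_mult_distrib s2 sum_distrib_left)
  also have "\<tau> * (sqrt 2 * \<gamma> * sqrt (\<Sum>i=1..N. (\<sigma> i)\<^sup>2)) = (\<tau> * s) * (sqrt 2 * \<gamma>)"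
    by (simp add: s_def)
  also have "(\<tau> * s)\<^sup>2 - (\<tau> * s) * (sqrt 2 * \<gamma>) = - \<gamma>\<^sup>2 / 2"
    unfolding ts u_def by (simp add: power_mult_distrib power_divide) (simp add: power2_eq_square)
  finally show ?thesis by simp
qed

text \<open>The normalised Chernoff parameter is \<open>u = \<tau> * s\<close>.  Of the gain \<open>sqrt 2 * u * \<gamma>\<close> the bound
  \<open>u \<le> \<gamma> / 28\<close> lets the quadratic cost \<open>7 * u\<^sup>2\<close> take at most a quarter of \<open>u * \<gamma>\<close> and the Young terms
  \<open>b i\<close> take at most an eighth; since \<open>sqrt 2 \<ge> 11 / 8\<close>, at least \<open>u * \<gamma>\<close> remains.\<close>

lemma powr_tail_bound:
  assumes C: "cond_C M F \<sigma> \<xi> \<alpha>"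
    and N: "N \<ge> 1" and \<alpha>: "1 \<le> \<alpha>"
    and s_def: "s = sqrt (\<Sum>i=1..N. (\<sigma> i)\<^sup>2)"
    and u: "0 \<le> u" "u \<le> \<gamma> / 28" and b: "\<And>i. 0 \<le> b i" "(\<Sum>i=1..N. b i) \<le> u * \<gamma> / 8"
    and young: "\<And>i x. 1 \<le> i \<Longrightarrow> i \<le> N \<Longrightarrow> 0 \<le> x \<Longrightarrow> u / s * \<sigma> i * x \<le> x powr \<alpha> + b i"
  shows "\<P>(\<omega> in M. norm (\<Sum>i=1..N. \<xi> i \<omega>) \<ge> (sqrt (2 * exp 1 * \<kappa>) + sqrt 2 * \<gamma>) * s)
    \<le> exp (- (u * \<gamma>))"
proof -
  have s: "s > 0"
    unfolding s_def lq_norm_2[symmetric] using sigma by (intro lq_norm_pos N) blast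
  have s2: "s\<^sup>2 = (\<Sum>i=1..N. (\<sigma> i)\<^sup>2)" by (simp add: s_def sum_nonneg)
  define \<tau> where "\<tau> = u / s"
  have \<tau>: "\<tau> \<ge> 0" using u s by (simp add: \<tau>_def)
  have ts: "\<tau> * s = u" using s by (simp add: \<tau>_def)
  have "\<P>(\<omega> in M. norm (\<Sum>i=1..N. \<xi> i \<omega>) \<ge> (sqrt (2 * exp 1 * \<kappa>) + sqrt 2 * \<gamma>) * sqrt (\<Sum>i=1..N. (\<sigma> i)\<^sup>2))
    \<le> exp ((\<Sum>i=1..N. 7 * (\<tau> * \<sigma> i)\<^sup>2 + b i) - \<tau> * (sqrt 2 * \<gamma> * sqrt (\<Sum>i=1..N. (\<sigma> i)\<^sup>2)))"
  proof (rule tail_bound_from_majorants[OF C N \<tau>])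
    show "affine_majorant \<alpha> m \<tau> (\<sigma> i) (exp 1 * \<tau> * m * (\<sigma> i)\<^sup>2 + (7 * (\<tau> * \<sigma> i)\<^sup>2 + b i))"
      if "1 \<le> i" "i \<le> N" "0 \<le> m" for i m
      using affine_majorant_powr[OF \<alpha> \<tau> that(3) sigma[OF that(1)] b(1) young[OF that(1,2), folded \<tau>_def]]
      by (simp add: add.assoc)
  qed auto
  also have "\<dots> \<le> exp (- (u * \<gamma>))"
  proof -
    have "(\<Sum>i=1..N. 7 * (\<tau> * \<sigma> i)\<^sup>2 + b i) = 7 * (\<tau> * s)\<^sup>2 + (\<Sum>i=1..N. b i)"
      by (simp add: power_mult_distrib s2 sum.distrib sum_distrib_left)
    moreover have "\<tau> * (sqrt 2 * \<gamma> * sqrt (\<Sum>i=1..N. (\<sigma> i)\<^sup>2)) = sqrt 2 * (u * \<gamma>)"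
      using ts by (simp add: s_def mult_ac)
    moreover have "7 * u\<^sup>2 \<le> u * \<gamma> / 4"
      using mult_left_mono[OF u(2) u(1)] by (simp add: power2_eq_square)
    moreover have "11 / 8 * (u * \<gamma>) \<le> sqrt 2 * (u * \<gamma>)"
    proof (rule mult_right_mono)
      show "11 / 8 \<le> sqrt 2" by (rule real_le_rsqrt) (simp add: power2_eq_square)
      show "0 \<le> u * \<gamma>" using u by simp
    qed
    ultimately show ?thesis using b(2) unfolding ts exp_le_cancel_iff by linarith
  qed
  finally show ?thesis by (simp add: s_def)
qed

text \<open>The parameter \<open>u\<close> is the smaller of \<open>\<gamma> / 28\<close> and the value at which the Young term
  \<open>(\<alpha> - 1) * (u / (\<alpha> * R)) powr q\<close> equals \<open>u * \<gamma> / 8\<close>.  In the second case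
  \<open>u * \<gamma> = \<alpha> / 16 * (\<gamma>\<^sub>* powr (2 - \<alpha>) * \<gamma> powr \<alpha>)\<close>, where \<open>\<gamma>\<^sub>*\<close> is \<open>gamma_star \<alpha> \<sigma> N\<close>.\<close>

lemma tail_bound_between_1_and_2:
  assumes C: "cond_C M F \<sigma> \<xi> \<alpha>"
    and N: "N \<ge> 1" and \<alpha>: "1 < \<alpha>" "\<alpha> < 2" and \<gamma>: "\<gamma> \<ge> 0"
  shows "\<P>(\<omega> in M. norm (\<Sum>i=1..N. \<xi> i \<omega>)
      \<ge> (sqrt (2 * exp 1 * \<kappa>) + sqrt 2 * \<gamma>) * sqrt (\<Sum>i=1..N. (\<sigma> i)\<^sup>2))
    \<le> exp (- (1 / 64) * tail_exponent \<alpha> (gamma_star \<alpha> \<sigma> N) \<gamma>)"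
proof -
  have sigma': "\<forall>i\<ge>1. \<sigma> i > 0" using sigma by blast
  define s where "s = sqrt (\<Sum>i=1..N. (\<sigma> i)\<^sup>2)"
  have s: "s > 0" unfolding s_def lq_norm_2[symmetric] by (rule lq_norm_pos[OF N sigma'])
  define q where "q = alpha_star \<alpha>"
  have q: "q > 2" unfolding q_def by (rule alpha_star_gt_2[OF \<alpha>])
  have qa: "(\<alpha> - 1) * (q - 1) = 1" "(\<alpha> - 1) * q = \<alpha>"
    using \<alpha>(1) by (auto simp: q_def alpha_star_def field_simps)
  define L where "L = lq_norm q \<sigma> N"
  have L: "L > 0" unfolding L_def by (rule lq_norm_pos[OF N sigma'])
  define R where "R = s / L"
  have R: "R > 0" using s L by (simp add: R_def)
  define w where "w = q * R * \<gamma> / 8"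
  have w: "w \<ge> 0" using q R \<gamma> by (simp add: w_def)
  define v where "v = w powr (\<alpha> - 1)"
  define u where "u = min (\<gamma> / 28) (\<alpha> * R * v)"
  have u: "0 \<le> u" "u \<le> \<gamma> / 28" using \<gamma> \<alpha> R by (auto simp: u_def v_def)
  define b where "b i = (\<alpha> - 1) * (u / s * \<sigma> i / \<alpha>) powr q" for i
  have "(\<Sum>i=1..N. b i) \<le> u * \<gamma> / 8"
  proof -
    define z where "z = u / (\<alpha> * R)"
    have z: "0 \<le> z" using u \<alpha> R by (simp add: z_def)
    have "z \<le> v" using \<alpha> R by (simp add: z_def u_def min_def pos_divide_le_eq mult.commute)
    then have "z powr (q - 1) \<le> v powr (q - 1)" using z q by (intro powr_mono2) auto
    also have "\<dots> = w" using w qa(1) by (simp add: v_def powr_powr)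
    finally have zw: "z powr (q - 1) \<le> w" .
    have b_eq: "b i = (\<alpha> - 1) * (u / (s * \<alpha>)) powr q * \<sigma> i powr q" if "i \<in> {1..N}" for i
    proof -
      have "\<sigma> i > 0" using sigma that by simp
      then have "(u / s * \<sigma> i / \<alpha>) powr q = (u / (s * \<alpha>)) powr q * \<sigma> i powr q"
        using u s \<alpha> by (simp flip: powr_mult)
      then show ?thesis by (simp add: b_def)
    qed
    have "(\<Sum>i=1..N. b i) = (\<alpha> - 1) * (u / (s * \<alpha>)) powr q * (\<Sum>i=1..N. \<sigma> i powr q)"
      unfolding sum_distrib_left using b_eq by (rule sum.cong[OF refl])
    also have "(\<Sum>i=1..N. \<sigma> i powr q) = L powr q"
      using lq_norm_powr[OF _ sigma', of q N] q by (simp add: L_def)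
    also have "(\<alpha> - 1) * (u / (s * \<alpha>)) powr q * L powr q = (\<alpha> - 1) * z powr q"
    proof -
      have "(u / (s * \<alpha>)) powr q * L powr q = (u / (s * \<alpha>) * L) powr q"
        using u s L \<alpha> by (intro powr_mult[symmetric]) 
      also have "u / (s * \<alpha>) * L = z" using L s by (simp add: z_def R_def)
      finally show ?thesis by simp
    qed
    also have "z powr q = z * z powr (q - 1)"
    proof (cases "z = 0")
      case False
      then have "z powr (1 + (q - 1)) = z powr 1 * z powr (q - 1)" by (intro powr_add)
      then show ?thesis using z False by simp
    qed simp
    also have "(\<alpha> - 1) * (z * z powr (q - 1)) \<le> (\<alpha> - 1) * (z * w)"
      using zw z \<alpha> by (intro mult_left_mono) auto
    also have "\<dots> = ((\<alpha> - 1) * q) * (z * R) * \<gamma> / 8" by (simp add: w_def)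
    also have "\<dots> = u * \<gamma> / 8" unfolding qa using \<alpha> R by (simp add: z_def)
    finally show ?thesis .
  qed
  moreover have "u / s * \<sigma> i * x \<le> x powr \<alpha> + b i" if "1 \<le> i" "0 \<le> x" for i x
    using mult_le_powr_plus_conjugate_powr[OF \<alpha>(1) that(2), of "u / s * \<sigma> i"] u s sigma[OF that(1)]
    by (simp add: b_def q_def alpha_star_def)
  moreover have "0 \<le> b i" for i using \<alpha> by (simp add: b_def)
  ultimately have "\<P>(\<omega> in M. norm (\<Sum>i=1..N. \<xi> i \<omega>) \<ge> (sqrt (2 * exp 1 * \<kappa>) + sqrt 2 * \<gamma>) * s)
    \<le> exp (- (u * \<gamma>))"
    using \<alpha>(1) u
    by (intro powr_tail_bound[OF C N _ s_def]) auto
  also have "exp (- (u * \<gamma>)) \<le> exp (- (1 / 64) * tail_exponent \<alpha> (gamma_star \<alpha> \<sigma> N) \<gamma>)"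
  proof -
    define G where "G = real_of_ereal (gamma_star \<alpha> \<sigma> N) powr (2 - \<alpha>)"
    have G: "G = 16 * (q / 8) powr (\<alpha> - 1) * R powr \<alpha>"
      unfolding G_def gamma_star_powr[OF \<alpha> N sigma'] q_def R_def L_def s_def lq_norm_2 ..
    have te: "tail_exponent \<alpha> (gamma_star \<alpha> \<sigma> N) \<gamma> = min (\<gamma>\<^sup>2) (G * \<gamma> powr \<alpha>)"
      using \<alpha> by (simp add: tail_exponent_def G_def gamma_star_def)
    have eq: "\<alpha> * R * v * \<gamma> = \<alpha> / 16 * (G * \<gamma> powr \<alpha>)"
    proof (cases "\<gamma> = 0")
      case False
      then have g: "\<gamma> > 0" using \<gamma> by simp
      have "v = ((q / 8) * (R * \<gamma>)) powr (\<alpha> - 1)" by (simp add: v_def w_def mult.assoc)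
      also have "\<dots> = (q / 8) powr (\<alpha> - 1) * (R * \<gamma>) powr (\<alpha> - 1)"
        using q R \<gamma> by (intro powr_mult) 
      finally have "R * v * \<gamma> = (q / 8) powr (\<alpha> - 1) * ((R * \<gamma>) powr 1 * (R * \<gamma>) powr (\<alpha> - 1))"
        using R g by simp
      also have "(R * \<gamma>) powr 1 * (R * \<gamma>) powr (\<alpha> - 1) = (R * \<gamma>) powr \<alpha>"
        unfolding powr_add[symmetric] by simp
      also have "\<dots> = R powr \<alpha> * \<gamma> powr \<alpha>" using R g by (intro powr_mult) 
      finally show ?thesis by (simp add: G)
    qed simp
    have "0 \<le> G * \<gamma> powr \<alpha>" by (simp add: G_def)
    then have "1 / 64 * (G * \<gamma> powr \<alpha>) \<le> \<alpha> / 16 * (G * \<gamma> powr \<alpha>)"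
      using \<alpha> by (intro mult_right_mono) auto
    moreover have "u * \<gamma> = min (\<gamma>\<^sup>2 / 28) (\<alpha> * R * v * \<gamma>)"
      using \<gamma> by (simp add: u_def min_mult_distrib_right power2_eq_square)
    moreover have "\<gamma>\<^sup>2 / 64 \<le> \<gamma>\<^sup>2 / 28" by simp
    moreover have "min (\<gamma>\<^sup>2) (G * \<gamma> powr \<alpha>) \<le> \<gamma>\<^sup>2" "min (\<gamma>\<^sup>2) (G * \<gamma> powr \<alpha>) \<le> G * \<gamma> powr \<alpha>"
      by simp_all
    moreover have "u * \<gamma> = \<gamma>\<^sup>2 / 28 \<or> u * \<gamma> = \<alpha> / 16 * (G * \<gamma> powr \<alpha>)"
      using calculation(2) unfolding eq min_def by argo
    ultimately have "1 / 64 * min (\<gamma>\<^sup>2) (G * \<gamma> powr \<alpha>) \<le> u * \<gamma>"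
      by linarith
    then show ?thesis unfolding te by simp
  qed
  finally show ?thesis by (simp add: s_def)
qed

text \<open>For \<open>\<alpha> = 1\<close> no Young term appears as long as \<open>\<tau> * \<sigma> i \<le> 1\<close> for every \<open>i\<close>, that is
  \<open>u \<le> s / linf_norm \<sigma> N\<close>; this cap turns the tail from Gaussian to exponential.\<close>

lemma tail_bound_1:
  assumes C: "cond_C M F \<sigma> \<xi> 1"
    and N: "N \<ge> 1" and \<gamma>: "\<gamma> \<ge> 0"
  shows "\<P>(\<omega> in M. norm (\<Sum>i=1..N. \<xi> i \<omega>)
      \<ge> (sqrt (2 * exp 1 * \<kappa>) + sqrt 2 * \<gamma>) * sqrt (\<Sum>i=1..N. (\<sigma> i)\<^sup>2))
    \<le> exp (- (1 / 64) * tail_exponent 1 (gamma_star 1 \<sigma> N) \<gamma>)"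
proof -
  have sigma': "\<forall>i\<ge>1. \<sigma> i > 0" using sigma by blast
  define s where "s = sqrt (\<Sum>i=1..N. (\<sigma> i)\<^sup>2)"
  have s: "s > 0" unfolding s_def lq_norm_2[symmetric] by (rule lq_norm_pos[OF N sigma'])
  define L where "L = linf_norm \<sigma> N"
  obtain j where "1 \<le> j" "L = \<bar>\<sigma> j\<bar>" unfolding L_def using linf_norm_attained[OF N] by blast
  then have L: "L > 0" using sigma' by auto
  define R where "R = s / L"
  have R: "R > 0" using s L by (simp add: R_def)
  define u where "u = min (\<gamma> / 28) R"
  have u: "0 \<le> u" "u \<le> \<gamma> / 28" "u \<le> R" using \<gamma> R by (auto simp: u_def)
  have "u / s * \<sigma> i * x \<le> x powr 1 + 0" if "1 \<le> i" "i \<le> N" "0 \<le> x" for i x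
  proof -
    have "\<sigma> i \<le> L" using linf_norm_ge[OF that(1,2), of \<sigma>] sigma[OF that(1)] by (simp add: L_def)
    then have "u * \<sigma> i \<le> R * L" using u R sigma[OF that(1)] by (intro mult_mono) auto
    then have "u / s * \<sigma> i \<le> 1" using L s by (simp add: R_def)
    then have "u / s * \<sigma> i * x \<le> 1 * x" using that(3) by (rule mult_right_mono)
    then show ?thesis using that(3) by simp
  qed
  then have "\<P>(\<omega> in M. norm (\<Sum>i=1..N. \<xi> i \<omega>) \<ge> (sqrt (2 * exp 1 * \<kappa>) + sqrt 2 * \<gamma>) * s)
    \<le> exp (- (u * \<gamma>))"
    using u \<gamma>
    by (intro powr_tail_bound[OF C N _ s_def, where b = "\<lambda>_. 0"]) auto
  also have "exp (- (u * \<gamma>)) \<le> exp (- (1 / 64) * tail_exponent 1 (gamma_star 1 \<sigma> N) \<gamma>)"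
  proof -
    have "tail_exponent 1 (gamma_star 1 \<sigma> N) \<gamma> = min (\<gamma>\<^sup>2) (16 * R * \<gamma>)"
    proof -
      have "gamma_star 1 \<sigma> N = ereal (16 * R)"
        by (simp add: gamma_star_def R_def L_def s_def lq_norm_2)
      then show ?thesis using \<gamma> R by (simp add: tail_exponent_def)
    qed
    moreover have "u * \<gamma> = min (\<gamma>\<^sup>2 / 28) (R * \<gamma>)"
      using \<gamma> by (simp add: u_def min_mult_distrib_right power2_eq_square)
    moreover have "0 \<le> R * \<gamma>" "\<gamma>\<^sup>2 / 64 \<le> \<gamma>\<^sup>2 / 28" using R \<gamma> by auto
    ultimately show ?thesis by (auto simp: min_def)
  qed
  finally show ?thesis by (simp add: s_def)
qed

lemma cond_C_2_of_bounded:
  assumes bounded: "\<forall>i\<ge>1. AE \<omega> in M. norm (\<xi> i \<omega>) \<le> \<sigma> i"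
  shows "cond_C M F \<sigma> \<xi> 2"
  unfolding cond_C_def
proof (intro allI impI)
  fix i :: nat assume i: "i \<ge> 1"
  interpret prob_space M by (rule prob)
  interpret finite_measure_subalgebra M "F (i - 1)" using M_subalg by unfold_locales
  let ?Z = "\<lambda>\<omega>. ennreal (exp (norm (\<xi> i \<omega>) powr 2 * \<sigma> i powr - 2))"
  have "\<xi> i \<in> borel_measurable (F i)" using mart i unfolding martingale_difference_def by blast
  then have [measurable]: "\<xi> i \<in> borel_measurable M" by (rule measurable_from_subalg[OF M_subalg])
  have "AE \<omega> in M. ?Z \<omega> \<le> ennreal (exp 1)"
    using bounded[rule_format, OF i]
  proof eventually_elim
    case (elim \<omega>)
    have "norm (\<xi> i \<omega>) powr 2 * \<sigma> i powr - 2 \<le> \<sigma> i powr 2 * \<sigma> i powr - 2"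
      using elim by (intro mult_right_mono powr_mono2) auto
    also have "\<dots> = 1" using sigma[OF i] unfolding powr_add[symmetric] by simp
    finally show ?case by (intro ennreal_leI) simp
  qed
  then have "AE \<omega> in M. nn_cond_exp M (F (i - 1)) ?Z \<omega> \<le> nn_cond_exp M (F (i - 1)) (\<lambda>_. ennreal (exp 1)) \<omega>"
    by (rule nn_cond_exp_mono) auto
  moreover have "AE \<omega> in M. ennreal (exp 1) = nn_cond_exp M (F (i - 1)) (\<lambda>_. ennreal (exp 1)) \<omega>"
    by (rule nn_cond_exp_F_meas) simp
  ultimately show "AE \<omega> in M. nn_cond_exp M (F (i - 1)) ?Z \<omega> \<le> ennreal (exp 1)"
    by eventually_elim simp
qed

end

theorem theorem2p1:
  fixes M :: "'w::polish_space measure"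
    and F :: "nat \<Rightarrow> 'w measure"
    and \<xi> :: "nat \<Rightarrow> 'w \<Rightarrow> 'e::{banach, second_countable_topology}"
    and \<sigma> :: "nat \<Rightarrow> real"
    and \<kappa> :: real
  assumes prob: "prob_space M" and borel: "sets M = sets borel"
    and subalg: "\<And>i. subalgebra M (F i)"
    and filt: "filtration (space M) F"
    and F0: "sets (F 0) = {{}, space M}"
    and fin_dim: "\<exists>B :: 'e set. finite B \<and> span B = UNIV"
    and kappa: "\<kappa> \<ge> 1"
    and regular: "kappa_regular \<kappa> (norm :: 'e \<Rightarrow> real)"
    and sigma: "\<And>i. i \<ge> 1 \<Longrightarrow> \<sigma> i > 0"
    and mart: "martingale_difference M F \<xi>"
  shows
    "(\<forall>\<alpha>. 1 \<le> \<alpha> \<and> \<alpha> \<le> 2 \<and> cond_C M F \<sigma> \<xi> \<alpha> \<longrightarrow>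
        (\<forall>N\<ge>1. \<forall>\<gamma>\<ge>0.
           \<P>(\<omega> in M. norm (\<Sum>i=1..N. \<xi> i \<omega>) \<ge>
               (sqrt (2 * exp 1 * \<kappa>) + sqrt 2 * \<gamma>) * sqrt (\<Sum>i=1..N. (\<sigma> i)\<^sup>2))
           \<le> 2 * exp (- (1 / 64) * tail_exponent \<alpha> (gamma_star \<alpha> \<sigma> N) \<gamma>))) \<and>
     (\<forall>\<alpha>. 1 < \<alpha> \<and> \<alpha> < 2 \<longrightarrow>
        (\<forall>N\<ge>1.
           gamma_star \<alpha> \<sigma> N \<ge>
             ereal (16 * (lq_norm 2 \<sigma> N / lq_norm (alpha_star \<alpha>) \<sigma> N) powr (\<alpha> / (2 - \<alpha>))) \<and>
           16 * (lq_norm 2 \<sigma> N / lq_norm (alpha_star \<alpha>) \<sigma> N) powr (\<alpha> / (2 - \<alpha>)) \<ge> 16)) \<and>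
     (\<forall>N\<ge>1. ((\<lambda>\<alpha>. gamma_star \<alpha> \<sigma> N) \<longlongrightarrow> gamma_star 1 \<sigma> N) (at_right 1)) \<and>
     (\<forall>N\<ge>1. ((\<lambda>\<alpha>. gamma_star \<alpha> \<sigma> N) \<longlongrightarrow> gamma_star 2 \<sigma> N) (at_left 2)) \<and>
     (cond_C M F \<sigma> \<xi> 2 \<longrightarrow>
        (\<forall>N\<ge>1. \<forall>\<gamma>\<ge>0.
           \<P>(\<omega> in M. norm (\<Sum>i=1..N. \<xi> i \<omega>) \<ge>
               (sqrt (2 * \<kappa>) + sqrt 2 * \<gamma>) * sqrt (\<Sum>i=1..N. (\<sigma> i)\<^sup>2))
           \<le> exp (- \<gamma>\<^sup>2 / 3))) \<and>
     ((\<forall>i\<ge>1. AE \<omega> in M. norm (\<xi> i \<omega>) \<le> \<sigma> i) \<longrightarrow>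
        (\<forall>N\<ge>1. \<forall>\<gamma>\<ge>0.
           \<P>(\<omega> in M. norm (\<Sum>i=1..N. \<xi> i \<omega>) \<ge>
               (sqrt (2 * \<kappa>) + sqrt 2 * \<gamma>) * sqrt (\<Sum>i=1..N. (\<sigma> i)\<^sup>2))
           \<le> exp (- \<gamma>\<^sup>2 / 2)))"
  proof -
  interpret regular_martingale_difference M F \<xi> \<sigma> \<kappa>
    by (intro regular_martingale_difference.intro prob subalg filt fin_dim regular sigma mart)
       (use kappa in simp)
  have sigma': "\<forall>i\<ge>1. \<sigma> i > 0" using sigma by blast
  have gauss: "\<P>(\<omega> in M. norm (\<Sum>i=1..N. \<xi> i \<omega>) \<ge> (sqrt (2 * \<kappa>) + sqrt 2 * \<gamma>) * sqrt (\<Sum>i=1..N. (\<sigma> i)\<^sup>2))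
      \<le> exp (- \<gamma>\<^sup>2 / 2)" if "cond_C M F \<sigma> \<xi> 2" "N \<ge> 1" "\<gamma> \<ge> 0" for N \<gamma>
    by (rule gaussian_tail_bound[OF that])
  have i: "\<P>(\<omega> in M. norm (\<Sum>i=1..N. \<xi> i \<omega>) \<ge>
               (sqrt (2 * exp 1 * \<kappa>) + sqrt 2 * \<gamma>) * sqrt (\<Sum>i=1..N. (\<sigma> i)\<^sup>2))
           \<le> 2 * exp (- (1 / 64) * tail_exponent \<alpha> (gamma_star \<alpha> \<sigma> N) \<gamma>)"
    if \<alpha>: "1 \<le> \<alpha>" "\<alpha> \<le> 2" and C: "cond_C M F \<sigma> \<xi> \<alpha>" and N: "N \<ge> 1" and \<gamma>: "\<gamma> \<ge> 0" for \<alpha> N \<gamma>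
  proof -
    consider "\<alpha> = 1" | "1 < \<alpha>" "\<alpha> < 2" | "\<alpha> = 2" using \<alpha> by linarith
    then have "\<P>(\<omega> in M. norm (\<Sum>i=1..N. \<xi> i \<omega>) \<ge>
               (sqrt (2 * exp 1 * \<kappa>) + sqrt 2 * \<gamma>) * sqrt (\<Sum>i=1..N. (\<sigma> i)\<^sup>2))
           \<le> exp (- (1 / 64) * tail_exponent \<alpha> (gamma_star \<alpha> \<sigma> N) \<gamma>)"
    proof cases
      case 1
      then show ?thesis
        using tail_bound_1[OF _ N \<gamma>] C by simp
    next
      case 2
      then show ?thesis
        by (intro tail_bound_between_1_and_2[OF C N _ _ \<gamma>])
    next
      case 3
      interpret prob_space M by (rule prob)
      define T where "T \<omega> = norm (\<Sum>i=1..N. \<xi> i \<omega>)" for \<omega>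
      define s where "s = sqrt (\<Sum>i=1..N. (\<sigma> i)\<^sup>2)"
      have s: "s \<ge> 0" by (simp add: s_def sum_nonneg)
      have "\<xi> i \<in> borel_measurable M" if "i \<in> {1..N}" for i
        using mart that unfolding martingale_difference_def
        by (intro measurable_from_subalg[OF subalg, of _ i]) simp
      then have T: "T \<in> borel_measurable M"
        unfolding T_def by (rule measurable_compose[OF borel_measurable_sum borel_measurable_norm])
      have "sqrt (2 * \<kappa>) \<le> sqrt (2 * exp 1 * \<kappa>)"
        using \<kappa> by (intro real_sqrt_le_mono) simp
      then have le: "(sqrt (2 * \<kappa>) + sqrt 2 * \<gamma>) * s \<le> (sqrt (2 * exp 1 * \<kappa>) + sqrt 2 * \<gamma>) * s"
        using s by (intro mult_right_mono[OF add_right_mono])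
      have "\<P>(\<omega> in M. T \<omega> \<ge> (sqrt (2 * exp 1 * \<kappa>) + sqrt 2 * \<gamma>) * s)
          \<le> \<P>(\<omega> in M. T \<omega> \<ge> (sqrt (2 * \<kappa>) + sqrt 2 * \<gamma>) * s)"
      proof (rule finite_measure_mono)
        show "{\<omega> \<in> space M. (sqrt (2 * exp 1 * \<kappa>) + sqrt 2 * \<gamma>) * s \<le> T \<omega>}
            \<subseteq> {\<omega> \<in> space M. (sqrt (2 * \<kappa>) + sqrt 2 * \<gamma>) * s \<le> T \<omega>}"
          using order_trans[OF le] by blast
        show "{\<omega> \<in> space M. (sqrt (2 * \<kappa>) + sqrt 2 * \<gamma>) * s \<le> T \<omega>} \<in> events"
          using T by measurable
      qed
      also have "\<dots> \<le> exp (- \<gamma>\<^sup>2 / 2)"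
        unfolding T_def s_def by (rule gauss[OF C[unfolded 3] N \<gamma>])
      also have "\<dots> \<le> exp (- (1 / 64) * tail_exponent \<alpha> (gamma_star \<alpha> \<sigma> N) \<gamma>)"
        using 3 by (simp add: tail_exponent_def gamma_star_def)
      finally show ?thesis unfolding T_def s_def .
    qed
    also have "\<dots> \<le> 2 * \<dots>" by simp
    finally show ?thesis .
  qed
  show ?thesis
  proof (intro conjI allI impI; (elim conjE)?)
    show "\<P>(\<omega> in M. norm (\<Sum>i=1..N. \<xi> i \<omega>) \<ge>
               (sqrt (2 * exp 1 * \<kappa>) + sqrt 2 * \<gamma>) * sqrt (\<Sum>i=1..N. (\<sigma> i)\<^sup>2))
           \<le> 2 * exp (- (1 / 64) * tail_exponent \<alpha> (gamma_star \<alpha> \<sigma> N) \<gamma>)"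
      if "1 \<le> \<alpha>" "\<alpha> \<le> 2" "cond_C M F \<sigma> \<xi> \<alpha>" "N \<ge> 1" "\<gamma> \<ge> 0" for \<alpha> N \<gamma>
      by (rule i[OF that])
    show "gamma_star \<alpha> \<sigma> N \<ge>
             ereal (16 * (lq_norm 2 \<sigma> N / lq_norm (alpha_star \<alpha>) \<sigma> N) powr (\<alpha> / (2 - \<alpha>)))"
      if "1 < \<alpha>" "\<alpha> < 2" "N \<ge> 1" for \<alpha> N
      by (rule gamma_star_ge[OF that(3) sigma' that(1,2)])
    show "16 * (lq_norm 2 \<sigma> N / lq_norm (alpha_star \<alpha>) \<sigma> N) powr (\<alpha> / (2 - \<alpha>)) \<ge> 16"
      if "1 < \<alpha>" "\<alpha> < 2" "N \<ge> 1" for \<alpha> N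
      using norm_ratio_ge_1[OF that(3) sigma' that(1,2)] by simp
    show "((\<lambda>\<alpha>. gamma_star \<alpha> \<sigma> N) \<longlongrightarrow> gamma_star 1 \<sigma> N) (at_right 1)" if "N \<ge> 1" for N
      by (rule gamma_star_tendsto_at_right_1[OF that sigma'])
    show "((\<lambda>\<alpha>. gamma_star \<alpha> \<sigma> N) \<longlongrightarrow> gamma_star 2 \<sigma> N) (at_left 2)" if "N \<ge> 1" for N
      by (rule gamma_star_tendsto_at_left_2[OF that sigma'])
    show "\<P>(\<omega> in M. norm (\<Sum>i=1..N. \<xi> i \<omega>) \<ge> (sqrt (2 * \<kappa>) + sqrt 2 * \<gamma>) * sqrt (\<Sum>i=1..N. (\<sigma> i)\<^sup>2))
        \<le> exp (- \<gamma>\<^sup>2 / 3)" if "cond_C M F \<sigma> \<xi> 2" "N \<ge> 1" "\<gamma> \<ge> 0" for N \<gamma>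
    proof (rule order_trans[OF gauss[OF that]])
      show "exp (- \<gamma>\<^sup>2 / 2) \<le> exp (- \<gamma>\<^sup>2 / 3)" by simp
    qed
    show "\<P>(\<omega> in M. norm (\<Sum>i=1..N. \<xi> i \<omega>) \<ge> (sqrt (2 * \<kappa>) + sqrt 2 * \<gamma>) * sqrt (\<Sum>i=1..N. (\<sigma> i)\<^sup>2))
        \<le> exp (- \<gamma>\<^sup>2 / 2)"
      if "\<forall>i\<ge>1. AE \<omega> in M. norm (\<xi> i \<omega>) \<le> \<sigma> i" "N \<ge> 1" "\<gamma> \<ge> 0" for N \<gamma>
      by (rule gauss[OF cond_C_2_of_bounded[OF that(1)] that(2,3)])
  qed
qed

end
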